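(* Let $d\ge 2$ and let $X=(X_1,\dots,X_d)$ be a random vector with components $X_j\in\mathbb{R}^{p_j}$, $p=\sum_{j=1}^d p_j$, and let $\mathcal{Q}(X)=\int_{\mathbb{R}^p}|\phi_X(t)-\phi_{\widetilde X}(t)|^2\,w_1(t)\,dt$ be the complete measure of mutual dependence. If $\mathrm{E}|X|<\infty$, then $\mathcal{Q}(X)\in[0,\infty)$, and $\mathcal{Q}(X)=0$ if and only if $X_1,\dots,X_d$ are mutually independent. In addition, $$\mathcal{Q}(X)=\mathrm{E}|X-\widetilde X'|+\mathrm{E}|X'-\widetilde X|-\mathrm{E}|X-X'|-\mathrm{E}|\widetilde X-\widetilde X'|.$$
   Context: Each component $X_j$ is a continuous random vector in $\mathbb{R}^{p_j}$ (its distribution is absolutely continuous with respect to Lebesgue measure). $|\cdot|$ is the Euclidean norm (modulus for complex numbers), $\langle\cdot,\cdot\rangle$ the Euclidean inner product. $\widetilde X=(\widetilde X_1,\dots,\widetilde X_d)$ is a random vector such that $\widetilde X_j$ has the same distribution as $X_j$ for each $j$, $\widetilde X_1,\dots,\widetilde X_d$ are mutually independent, and $\widetilde X$ is independent of $X$. $X'$ is an independent copy of $X$ and $\widetilde X'$ an independent copy of $\widetilde X$; $X,X',\widetilde X,\widetilde X'$ are mutually independent. For $t=(t_1,\dots,t_d)\in\mathbb{R}^p$ with $t_j\in\mathbb{R}^{p_j}$, $\phi_X(t)=\mathrm{E}[e^{i\langle t,X\rangle}]$ and $\phi_{\widetilde X}(t)=\prod_{j=1}^d\mathrm{E}[e^{i\langle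 t_j,X_j\rangle}]$. The weight function is $w_1(t)=(K_p|t|^{p+1})^{-1}$ with $K_q=\frac{2\pi^{q/2}\Gamma(1/2)}{2\,\Gamma((q+1)/2)}=\frac{\pi^{(q+1)/2}}{\Gamma((q+1)/2)}$. *)

theory Defs
  imports "HOL-Probability.Probability"
begin

text \<open>
  Vectors with \<open>n\<close> real coordinates are extensional functions on \<open>{..<n}\<close>. A vector
  \<open>t = (t\<^sub>1, \<dots>, t\<^sub>d)\<close> with blocks of dimensions \<open>p\<^sub>1, \<dots>, p\<^sub>d\<close> is a function
  \<open>t :: nat \<Rightarrow> nat \<Rightarrow> real\<close> with blocks \<open>t j\<close>, \<open>j < d\<close>, of dimension \<open>p j\<close>; blocks and
  coordinates are numbered from \<open>0\<close>. The two measures below are Lebesgue measure on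
  the Borel sets; their sigma-algebras also serve as target spaces of random vectors.
\<close>

definition euclid :: "nat \<Rightarrow> (nat \<Rightarrow> real) measure" where
  "euclid n = (\<Pi>\<^sub>M k\<in>{..<n}. lborel)"

definition block_space :: "nat \<Rightarrow> (nat \<Rightarrow> nat) \<Rightarrow> (nat \<Rightarrow> nat \<Rightarrow> real) measure" where
  "block_space d p = (\<Pi>\<^sub>M j\<in>{..<d}. euclid (p j))"

definition euclid_inner :: "nat \<Rightarrow> (nat \<Rightarrow> real) \<Rightarrow> (nat \<Rightarrow> real) \<Rightarrow> real" where
  "euclid_inner n x y = (\<Sum>k<n. x k * y k)"

definition block_inner ::
    "nat \<Rightarrow> (nat \<Rightarrow> nat) \<Rightarrow> (nat \<Rightarrow> nat \<Rightarrow> real) \<Rightarrow> (nat \<Rightarrow> nat \<Rightarrow> real) \<Rightarrow> real" where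
  "block_inner d p x y = (\<Sum>j<d. euclid_inner (p j) (x j) (y j))"

definition block_norm :: "nat \<Rightarrow> (nat \<Rightarrow> nat) \<Rightarrow> (nat \<Rightarrow> nat \<Rightarrow> real) \<Rightarrow> real" where
  "block_norm d p x = sqrt (block_inner d p x x)"

definition block_dist ::
    "nat \<Rightarrow> (nat \<Rightarrow> nat) \<Rightarrow> (nat \<Rightarrow> nat \<Rightarrow> real) \<Rightarrow> (nat \<Rightarrow> nat \<Rightarrow> real) \<Rightarrow> real" where
  "block_dist d p x y = block_norm d p (\<lambda>j k. x j k - y j k)"

definition joint_char ::
    "'a measure \<Rightarrow> nat \<Rightarrow> (nat \<Rightarrow> nat) \<Rightarrow> ('a \<Rightarrow> nat \<Rightarrow> nat \<Rightarrow> real)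
      \<Rightarrow> (nat \<Rightarrow> nat \<Rightarrow> real) \<Rightarrow> complex" where
  "joint_char M d p X t = (LINT \<omega>|M. iexp (block_inner d p t (X \<omega>)))"

definition product_char ::
    "'a measure \<Rightarrow> nat \<Rightarrow> (nat \<Rightarrow> nat) \<Rightarrow> ('a \<Rightarrow> nat \<Rightarrow> nat \<Rightarrow> real)
      \<Rightarrow> (nat \<Rightarrow> nat \<Rightarrow> real) \<Rightarrow> complex" where
  "product_char M d p X t = (\<Prod>j<d. LINT \<omega>|M. iexp (euclid_inner (p j) (t j) (X \<omega> j)))"

definition K_const :: "nat \<Rightarrow> real" where
  "K_const q = 2 * pi powr (real q / 2) * Gamma (1 / 2) / (2 * Gamma ((real q + 1) / 2))"

text \<open>At \<open>t = 0\<close>, a null set, the weight is \<open>0\<close> by the convention for division by zero.\<close>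

definition weight :: "nat \<Rightarrow> (nat \<Rightarrow> nat) \<Rightarrow> (nat \<Rightarrow> nat \<Rightarrow> real) \<Rightarrow> real" where
  "weight d p t =
     1 / (K_const (\<Sum>j<d. p j) * block_norm d p t ^ ((\<Sum>j<d. p j) + 1))"

text \<open>
  The complete measure of mutual dependence takes values in \<open>[0, \<infinity>]\<close>, so that its
  finiteness is a genuine claim.
\<close>

definition complete_dependence ::
    "'a measure \<Rightarrow> nat \<Rightarrow> (nat \<Rightarrow> nat) \<Rightarrow> ('a \<Rightarrow> nat \<Rightarrow> nat \<Rightarrow> real) \<Rightarrow> ennreal" where
  "complete_dependence M d p X =
     (\<integral>\<^sup>+ t. ennreal ((cmod (joint_char M d p X t - product_char M d p X t))\<^sup>2 * weight d p t)
       \<partial>block_space d p)"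

end

theory Submission
  imports Defs
begin

text \<open>
  Let \<open>\<mu>\<close> be the law of \<open>X\<close> and \<open>\<nu>\<close> the product of its block marginals. The weight is the one for
  which the integral of \<open>(1 - cos \<langle>t, z\<rangle>) w(t)\<close> equals \<open>|z|\<close>. Hence, with
  \<open>D(\<mu>, \<nu>)(t) = E (1 - cos \<langle>t, x - y\<rangle>)\<close> for independent \<open>x\<close>, \<open>y\<close> with laws \<open>\<mu>\<close>, \<open>\<nu>\<close>, the identity
  \<open>|\<phi>\<^sub>\<mu> - \<phi>\<^sub>\<nu>|\<^sup>2 + D(\<mu>, \<mu>) + D(\<nu>, \<nu>) = 2 D(\<mu>, \<nu>)\<close> integrates, all terms being nonnegative, to the energy
  formula; finiteness follows from the first moments. If the integral vanishes, the characteristic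
  functions agree almost everywhere, so the convolutions of \<open>\<mu>\<close> and \<open>\<nu>\<close> with Gaussians agree, and
  letting the variance tend to \<open>0\<close> on lower boxes gives \<open>\<mu> = \<nu>\<close>.
\<close>

section \<open>One-dimensional Gaussian integrals\<close>

text \<open>The exponent and the constant of the weight have a simple origin. With \<open>n\<close>
  the total dimension, \<open>|t|\<close> to the power \<open>- (n + 1)\<close> is, up to a
  constant, the integral over \<open>r > 0\<close> of \<open>r ^ n\<close> times the Gaussian
  \<open>exp (- r^2 |t|^2)\<close>. The Fourier transform of that Gaussian carries the factor
  \<open>(sqrt pi / r) ^ n\<close>, so the powers of \<open>r\<close> cancel; what remains, the
  integral of \<open>1 - exp (- |z|^2 / (4 r^2))\<close> over \<open>r\<close>, is a multiple of
  \<open>|z|\<close> by scaling. The weight alone is not integrable near \<open>0\<close>; the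
  kernel \<open>1 - cos\<close> repairs this. The kernel is also nonnegative, so every exchange of
  integrals with it is Tonelli in \<open>[0, \<infinity>]\<close>, and moments enter only for
  finiteness and for the final subtraction. The same kernel replaces Fourier inversion: integrated
  against a Gaussian instead of the weight, it yields a multiple of \<open>1\<close> minus a
  Gaussian, so that a Gaussian convolution is determined by the characteristic function modulo null
  sets.\<close>

lemma Gamma_nat_plus_half:
  "Gamma (real k + 1 / 2) = sqrt pi * (fact (2 * k) / (2 ^ (2 * k) * fact k))"
proof (induction k)
  case 0
  then show ?case by (simp add: Gamma_one_half_real)
next
  case (Suc k)
  have "Gamma (real (Suc k) + 1 / 2) = Gamma ((real k + 1 / 2) + 1)"
    by (simp add: add_ac)
  also have "\<dots> = (real k + 1 / 2) * Gamma (real k + 1 / 2)"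
    by (rule Gamma_plus1) (auto elim!: nonpos_Ints_cases)
  also have "\<dots> = sqrt pi *
      ((2 * real k + 2) * (2 * real k + 1) * fact (2 * k) / (4 * 2 ^ (2 * k) * ((real k + 1) * fact k)))"
    unfolding Suc by (simp add: divide_simps) (simp add: algebra_simps)
  finally show ?case
    by (simp add: algebra_simps)
qed

text \<open>The classical moment formulas split by parity; the Gamma form joins both cases, since
  the exponent will be an arbitrary total dimension. It is also the source of the Gamma factor in
  \<open>K_const\<close>. Leaving out the null point \<open>0\<close> keeps the later integrands
  where division by \<open>r\<close> is harmless.\<close>

lemma nn_integral_gaussian_moment:
  "(\<integral>\<^sup>+x. ennreal (indicator {0<..} x * (x ^ n * exp (- x\<^sup>2))) \<partial>lborel)
     = ennreal (Gamma ((real n + 1) / 2) / 2)"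
proof -
  have "has_bochner_integral lborel (\<lambda>x::real. indicator {0..} x *\<^sub>R (exp (- x\<^sup>2) * x ^ n))
      (Gamma ((real n + 1) / 2) / 2)"
  proof (cases "even n")
    case True
    then obtain k where k: "n = 2 * k" by (elim evenE)
    have "(real n + 1) / 2 = real k + 1 / 2" by (simp add: k field_simps)
    then show ?thesis
      using gaussian_moment_even_pos[of k] unfolding \<open>(real n + 1) / 2 = _\<close> Gamma_nat_plus_half
      by (simp add: k mult_ac)
  next
    case False
    then obtain k where k: "n = 2 * k + 1" by (elim oddE)
    have "(real n + 1) / 2 = 1 + real k" by (simp add: k field_simps)
    then show ?thesis
      using gaussian_moment_odd_pos[of k] unfolding \<open>(real n + 1) / 2 = _\<close> Gamma_fact
      by (simp add: k)
  qed
  then have "(\<integral>\<^sup>+x. ennreal (indicator {0..} x *\<^sub>R (exp (- x\<^sup>2) * x ^ n)) \<partial>lborel)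
      = ennreal (Gamma ((real n + 1) / 2) / 2)"
    by (subst nn_integral_eq_integral)
       (auto simp: has_bochner_integral_iff indicator_def)
  moreover have "(\<integral>\<^sup>+x. ennreal (indicator {0<..} x * (x ^ n * exp (- x\<^sup>2))) \<partial>lborel)
      = (\<integral>\<^sup>+x. ennreal (indicator {0..} x *\<^sub>R (exp (- x\<^sup>2) * x ^ n)) \<partial>lborel)"
  proof (rule nn_integral_cong_AE)
    show "AE x in lborel. ennreal (indicator {0<..} x * (x ^ n * exp (- x\<^sup>2)))
        = ennreal (indicator {0..} x *\<^sub>R (exp (- x\<^sup>2) * x ^ n))"
      using AE_lborel_singleton[of "0::real"] by eventually_elim (auto simp: indicator_def)
  qed
  ultimately show ?thesis
    by (rule trans[rotated])
qed

lemma nn_integral_gaussian_moment_scaled: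
  assumes s: "s > 0"
  shows "(\<integral>\<^sup>+r. ennreal (indicator {0<..} r * (r ^ n * exp (- (r\<^sup>2 * s\<^sup>2)))) \<partial>lborel)
     = ennreal (Gamma ((real n + 1) / 2) / (2 * s ^ (n + 1)))"
proof -
  let ?f = "\<lambda>x::real. ennreal (indicator {0<..} x * (x ^ n * exp (- x\<^sup>2)))"
  let ?J = "\<integral>\<^sup>+r. ennreal (indicator {0<..} r * (r ^ n * exp (- (r\<^sup>2 * s\<^sup>2)))) \<partial>lborel"
  have "ennreal (Gamma ((real n + 1) / 2) / 2) = ennreal \<bar>s\<bar> * (\<integral>\<^sup>+x. ?f (0 + s * x) \<partial>lborel)"
    using s by (subst nn_integral_gaussian_moment[symmetric], intro nn_integral_real_affine) auto
  also have "(\<lambda>x. ?f (0 + s * x)) =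
      (\<lambda>r. ennreal (s ^ n) * ennreal (indicator {0<..} r * (r ^ n * exp (- (r\<^sup>2 * s\<^sup>2)))))"
    using s by (intro ext)
      (auto simp: indicator_def zero_less_mult_iff power_mult_distrib mult_ac
        simp flip: ennreal_mult')
  also have "integral\<^sup>N lborel \<dots> = ennreal (s ^ n) * ?J"
    by (rule nn_integral_cmult) auto
  finally have *: "ennreal (Gamma ((real n + 1) / 2) / 2) = ennreal (s ^ (n + 1)) * ?J"
    using s by (simp add: ennreal_mult mult_ac)
  have "?J = ennreal (1 / s ^ (n + 1)) * (ennreal (s ^ (n + 1)) * ?J)"
    using s by (simp add: mult.assoc[symmetric] ennreal_mult'[symmetric])
  also have "\<dots> = ennreal (1 / s ^ (n + 1)) * ennreal (Gamma ((real n + 1) / 2) / 2)"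
    by (simp only: *)
  also have "\<dots> = ennreal (Gamma ((real n + 1) / 2) / (2 * s ^ (n + 1)))"
    using s by (subst ennreal_mult'[symmetric]) (auto simp: field_simps)
  finally show ?thesis .
qed

text \<open>For \<open>r > 0\<close>, \<open>1 - exp (- (a / (2 * r))\<^sup>2)\<close> is the
  integral of \<open>2 * u * exp (- u\<^sup>2)\<close> over \<open>0 < u \<le> a / (2 * r)\<close>.
  The region \<open>2 * u * r \<le> a\<close> is symmetric in \<open>u\<close> and \<open>r\<close>,
  so integrating over \<open>r\<close> first gives the length \<open>a / (2 * u)\<close>, which
  cancels \<open>2 * u\<close> and leaves half a Gaussian integral.\<close>

lemma nn_integral_one_minus_gaussian:
  fixes a :: real
  assumes a: "a \<ge> 0"
  shows "(\<integral>\<^sup>+r. ennreal (indicator {0<..} r * (1 - exp (- (a\<^sup>2 / (4 * r\<^sup>2))))) \<partial>lborel)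
     = ennreal (a * sqrt pi / 2)"
proof -
  define g where "g r u = ennreal (indicator {0<..} r * indicator {0<..} u *
    indicator {..a} (2 * u * r) * (2 * u * exp (- u\<^sup>2)))" for r u :: real
  have [measurable]: "case_prod g \<in> borel_measurable (lborel \<Otimes>\<^sub>M lborel)"
    unfolding g_def by measurable
  have inner: "(\<integral>\<^sup>+u. g r u \<partial>lborel) =
      ennreal (indicator {0<..} r * (1 - exp (- (a\<^sup>2 / (4 * r\<^sup>2)))))" for r
  proof (cases "r > 0")
    case True
    have "AE u in lborel. g r u
        = ennreal (2 * u * exp (- u\<^sup>2)) * indicator {0..a / (2 * r)} u"
      using AE_lborel_singleton[of "0::real"]
      by eventually_elim (use True a in \<open>auto simp: g_def indicator_def field_simps\<close>)
    then have "(\<integral>\<^sup>+u. g r u \<partial>lborel)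
        = (\<integral>\<^sup>+u. ennreal (2 * u * exp (- u\<^sup>2)) * indicator {0..a / (2 * r)} u \<partial>lborel)"
      by (rule nn_integral_cong_AE)
    also have "\<dots> = ennreal (- exp (- (a / (2 * r))\<^sup>2) - - exp (- 0\<^sup>2))"
      by (rule nn_integral_FTC_Icc)
         (use True a in \<open>auto intro!: derivative_eq_intros simp: field_simps\<close>)
    finally show ?thesis
      using True by (simp add: power_divide power_mult_distrib)
  qed (simp add: g_def)
  have outer: "(\<integral>\<^sup>+r. g r u \<partial>lborel)
      = ennreal a * ennreal (indicator {0<..} u * (u ^ 0 * exp (- u\<^sup>2)))" for u
  proof (cases "u > 0")
    case True
    have "(\<integral>\<^sup>+r. g r u \<partial>lborel)
        = (\<integral>\<^sup>+r. ennreal (2 * u * exp (- u\<^sup>2)) * indicator {0<..a / (2 * u)} r \<partial>lborel)"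
      by (intro nn_integral_cong)
         (use True in \<open>auto simp: g_def indicator_def field_simps\<close>)
    also have "\<dots> = ennreal (2 * u * exp (- u\<^sup>2)) * ennreal (a / (2 * u))"
      using True a by (subst nn_integral_cmult_indicator) auto
    also have "\<dots> = ennreal (a * exp (- u\<^sup>2))"
      using True a by (subst ennreal_mult[symmetric]) auto
    finally show ?thesis
      using True a by (simp add: ennreal_mult')
  qed (simp add: g_def)
  have "(\<integral>\<^sup>+r. \<integral>\<^sup>+u. g r u \<partial>lborel \<partial>lborel) = (\<integral>\<^sup>+u. \<integral>\<^sup>+r. g r u \<partial>lborel \<partial>lborel)"
    by (rule lborel_pair.Fubini'[symmetric]) measurable
  also have "\<dots> = ennreal a * ennreal (Gamma ((real 0 + 1) / 2) / 2)"
    unfolding outer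
    by (subst nn_integral_cmult) (simp_all only: nn_integral_gaussian_moment, measurable)
  also have "\<dots> = ennreal (a * sqrt pi / 2)"
    using a by (simp add: ennreal_mult'[symmetric] Gamma_one_half_real)
  finally show ?thesis
    unfolding inner .
qed

lemma gaussian_Fourier:
  fixes r z :: real
  assumes r: "r > 0"
  shows "integrable lborel (\<lambda>x. complex_of_real (exp (- (r\<^sup>2 * x\<^sup>2))) * iexp (x * z))" (is "integrable _ ?g")
    and "(LINT x|lborel. complex_of_real (exp (- (r\<^sup>2 * x\<^sup>2))) * iexp (x * z))
      = complex_of_real (sqrt pi / r * exp (- (z\<^sup>2 / (4 * r\<^sup>2))))"
proof -
  \<comment> \<open>Substituting \<open>x / ?c\<close> turns \<open>r\<^sup>2 * x\<^sup>2\<close>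
    into \<open>x\<^sup>2 / 2\<close>, and the integral into the characteristic function of the
    standard normal law at \<open>?t\<close>.\<close>
  let ?c = "sqrt 2 * r"
  let ?t = "z / ?c"
  have c: "?c > 0" using r by simp
  have *: "?g (0 + 1 / ?c * x) = complex_of_real (sqrt (2 * pi)) * (std_normal_density x *\<^sub>R iexp (?t * x))"
    for x
  proof -
    have "r\<^sup>2 * (0 + 1 / ?c * x)\<^sup>2 = x\<^sup>2 / 2"
      using r by (simp add: power_divide power_mult_distrib)
    moreover have "(0 + 1 / ?c * x) * z = ?t * x" by simp
    moreover have "exp (- (x\<^sup>2 / 2)) = sqrt (2 * pi) * std_normal_density x"
      by (simp add: std_normal_density_def)
    ultimately show ?thesis
      by (simp only: of_real_mult scaleR_conv_of_real mult.assoc)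
  qed
  have "integrable std_normal_distribution (\<lambda>x. iexp (?t * x))"
    by (rule finite_measure.integrable_const_bound[where B = 1])
       (auto simp: prob_space.finite_measure[OF prob_space_normal_density])
  then have "integrable lborel (\<lambda>x. std_normal_density x *\<^sub>R iexp (?t * x))"
    by (subst (asm) integrable_density) auto
  then have "integrable lborel (\<lambda>x. ?g (0 + 1 / ?c * x))"
    unfolding * by (rule integrable_mult_right)
  then show "integrable lborel ?g"
    using c by (subst (asm) lborel_integrable_real_affine_iff) auto
  have char: "complex_of_real (exp (- (?t\<^sup>2) / 2)) = (LINT x|std_normal_distribution. iexp (?t * x))"
    using fun_cong[OF char_std_normal_distribution, of ?t] by (simp only: char_def)
  have dens: "(LINT x|std_normal_distribution. iexp (?t * x))
      = (LINT x|lborel. std_normal_density x *\<^sub>R iexp (?t * x))"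
    by (subst integral_density) auto
  have "(LINT x|lborel. ?g x) = \<bar>1 / ?c\<bar> *\<^sub>R (LINT x|lborel. ?g (0 + 1 / ?c * x))"
    using r by (intro lborel_integral_real_affine) simp
  also have "(LINT x|lborel. ?g (0 + 1 / ?c * x))
      = complex_of_real (sqrt (2 * pi)) * complex_of_real (exp (- (?t\<^sup>2) / 2))"
    unfolding * char dens by (rule integral_mult_right_zero)
  also have "\<bar>1 / ?c\<bar> *\<^sub>R (complex_of_real (sqrt (2 * pi)) * complex_of_real (exp (- (?t\<^sup>2) / 2)))
      = complex_of_real (sqrt pi / r) * complex_of_real (exp (- (?t\<^sup>2) / 2))"
    using r by (simp add: scaleR_conv_of_real real_sqrt_mult)
  also have "- (?t\<^sup>2) / 2 = - (z\<^sup>2 / (4 * r\<^sup>2))"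
    using r by (simp add: power_divide power_mult_distrib)
  finally show "(LINT x|lborel. ?g x) = complex_of_real (sqrt pi / r * exp (- (z\<^sup>2 / (4 * r\<^sup>2))))"
    by simp
qed

section \<open>Gaussian integrals on the block space\<close>

lemma product_sigma_finite_lborel: "product_sigma_finite (\<lambda>_. lborel :: real measure)"
  by (simp add: product_sigma_finite_def lborel.sigma_finite_measure_axioms)

lemma product_sigma_finite_euclid: "product_sigma_finite (\<lambda>j. euclid (p j))"
  unfolding product_sigma_finite_def euclid_def
  using product_sigma_finite.sigma_finite[OF product_sigma_finite_lborel] by auto

lemma sigma_finite_block_space: "sigma_finite_measure (block_space d p)"
  unfolding block_space_def
  by (rule product_sigma_finite.sigma_finite[OF product_sigma_finite_euclid]) simp

section \<open>Measurability and algebra of the block inner product\<close>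

lemma measurable_euclid_component:
  "k < n \<Longrightarrow> (\<lambda>x. x k) \<in> borel_measurable (euclid n)"
  using measurable_component_singleton[of k "{..<n}" "\<lambda>_. lborel"]
  by (simp add: euclid_def)

lemma measurable_block_component:
  "j < d \<Longrightarrow> (\<lambda>x. x j) \<in> measurable (block_space d p) (euclid (p j))"
  unfolding block_space_def by (rule measurable_component_singleton) simp

lemma measurable_coordinate:
  assumes "f \<in> measurable N (block_space d p)" "j < d" "k < p j"
  shows "(\<lambda>x. f x j k) \<in> borel_measurable N"
  using measurable_compose[OF measurable_compose[OF assms(1) measurable_block_component[OF assms(2)]]
      measurable_euclid_component[OF assms(3)]] .

lemma borel_measurable_block_inner:
  assumes "\<And>j k. j < d \<Longrightarrow> k < p j \<Longrightarrow> (\<lambda>x. f x j k) \<in> borel_measurable N"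
    and "\<And>j k. j < d \<Longrightarrow> k < p j \<Longrightarrow> (\<lambda>x. g x j k) \<in> borel_measurable N"
  shows "(\<lambda>x. block_inner d p (f x) (g x)) \<in> borel_measurable N"
  unfolding block_inner_def euclid_inner_def
  by (intro borel_measurable_sum borel_measurable_times assms) auto

lemma borel_measurable_block_inner_right:
  assumes "f \<in> measurable N (block_space d p)"
  shows "(\<lambda>x. block_inner d p (f x) z) \<in> borel_measurable N"
  by (rule borel_measurable_block_inner) (auto intro: measurable_coordinate[OF assms])

lemma borel_measurable_block_inner_left:
  assumes "f \<in> measurable N (block_space d p)"
  shows "(\<lambda>x. block_inner d p t (f x)) \<in> borel_measurable N"
  by (rule borel_measurable_block_inner) (auto intro: measurable_coordinate[OF assms])

lemma borel_measurable_block_inner_self: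
  assumes "f \<in> measurable N (block_space d p)"
  shows "(\<lambda>x. block_inner d p (f x) (f x)) \<in> borel_measurable N"
  by (rule borel_measurable_block_inner) (auto intro: measurable_coordinate[OF assms])

lemma borel_measurable_block_dist:
  assumes "f \<in> measurable N (block_space d p)" "g \<in> measurable N (block_space d p)"
  shows "(\<lambda>x. block_dist d p (f x) (g x)) \<in> borel_measurable N"
proof -
  have [measurable]: "(\<lambda>x. block_inner d p (\<lambda>j k. f x j k - g x j k) (\<lambda>j k. f x j k - g x j k))
      \<in> borel_measurable N"
    by (rule borel_measurable_block_inner)
       (auto intro: borel_measurable_diff measurable_coordinate[OF assms(1)] measurable_coordinate[OF assms(2)])
  show ?thesis
    unfolding block_dist_def block_norm_def by measurable
qed

lemmas borel_measurable_block_inner_id [measurable] =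
  borel_measurable_block_inner_right[OF measurable_ident[unfolded id_def]]
  borel_measurable_block_inner_left[OF measurable_ident[unfolded id_def]]
  borel_measurable_block_inner_self[OF measurable_ident[unfolded id_def]]

lemma borel_measurable_block_norm [measurable]: "block_norm d p \<in> borel_measurable (block_space d p)"
  unfolding block_norm_def by measurable

lemma borel_measurable_weight [measurable]: "weight d p \<in> borel_measurable (block_space d p)"
  unfolding weight_def by measurable

lemma block_inner_self_nonneg: "block_inner d p x x \<ge> 0"
  unfolding block_inner_def euclid_inner_def by (intro sum_nonneg) auto

lemma block_norm_nonneg: "block_norm d p x \<ge> 0"
  unfolding block_norm_def by (simp add: block_inner_self_nonneg)

lemma block_norm_power2: "(block_norm d p x)\<^sup>2 = block_inner d p x x"
  unfolding block_norm_def by (simp add: block_inner_self_nonneg)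

lemma block_inner_diff:
  "block_inner d p t (\<lambda>j k. x j k - y j k) = block_inner d p t x - block_inner d p t y"
  unfolding block_inner_def euclid_inner_def
  by (simp add: right_diff_distrib sum_subtractf)

lemma block_norm_eq_0_iff: "block_norm d p x = 0 \<longleftrightarrow> (\<forall>j<d. \<forall>k<p j. x j k = 0)"
  unfolding block_norm_def block_inner_def euclid_inner_def
  by (auto simp: sum_nonneg_eq_0_iff sum_nonneg)

lemma block_inner_norm_0: "block_norm d p t = 0 \<Longrightarrow> block_inner d p t x = 0"
  unfolding block_norm_eq_0_iff by (simp add: block_inner_def euclid_inner_def)

section \<open>Product integrals over all coordinates and the transform of an isotropic
  Gaussian\<close>

lemma nn_integral_block_space_prod:
  assumes f: "\<And>j k. f j k \<in> borel_measurable borel"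
  shows "(\<integral>\<^sup>+t. (\<Prod>j<d. \<Prod>k<p j. f j k (t j k)) \<partial>block_space d p)
    = (\<Prod>j<d. \<Prod>k<p j. \<integral>\<^sup>+x. f j k x \<partial>lborel)"
proof -
  have [measurable]: "(\<lambda>x. \<Prod>k<p j. f j k (x k)) \<in> borel_measurable (euclid (p j))" for j
    by (intro borel_measurable_prod_ennreal measurable_compose[OF measurable_euclid_component f]) auto
  have "(\<integral>\<^sup>+t. (\<Prod>j<d. \<Prod>k<p j. f j k (t j k)) \<partial>block_space d p)
      = (\<Prod>j<d. \<integral>\<^sup>+x. (\<Prod>k<p j. f j k (x k)) \<partial>euclid (p j))"
    unfolding block_space_def
    by (rule product_sigma_finite.product_nn_integral_prod[OF product_sigma_finite_euclid]) auto
  also have "\<dots> = (\<Prod>j<d. \<Prod>k<p j. \<integral>\<^sup>+x. f j k x \<partial>lborel)"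
    unfolding euclid_def
    by (intro prod.cong refl
        product_sigma_finite.product_nn_integral_prod[OF product_sigma_finite_lborel])
       (use f in auto)
  finally show ?thesis .
qed

lemma
  fixes f :: "nat \<Rightarrow> nat \<Rightarrow> real \<Rightarrow> complex"
  assumes f: "\<And>j k. integrable lborel (f j k)"
  shows integrable_block_space_prod:
      "integrable (block_space d p) (\<lambda>t. \<Prod>j<d. \<Prod>k<p j. f j k (t j k))"
    and integral_block_space_prod:
      "(LINT t|block_space d p. (\<Prod>j<d. \<Prod>k<p j. f j k (t j k)))
        = (\<Prod>j<d. \<Prod>k<p j. LINT x|lborel. f j k x)"
proof -
  have int: "integrable (euclid (p j)) (\<lambda>x. \<Prod>k<p j. f j k (x k))" for j
    unfolding euclid_def
    by (rule product_sigma_finite.product_integrable_prod[OF product_sigma_finite_lborel])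
       (use f in auto)
  show "integrable (block_space d p) (\<lambda>t. \<Prod>j<d. \<Prod>k<p j. f j k (t j k))"
    unfolding block_space_def
    by (rule product_sigma_finite.product_integrable_prod[OF product_sigma_finite_euclid])
       (use int in auto)
  have "(LINT t|block_space d p. (\<Prod>j<d. \<Prod>k<p j. f j k (t j k)))
      = (\<Prod>j<d. LINT x|euclid (p j). (\<Prod>k<p j. f j k (x k)))"
    unfolding block_space_def
    by (rule product_sigma_finite.product_integral_prod[OF product_sigma_finite_euclid])
       (use int in auto)
  also have "\<dots> = (\<Prod>j<d. \<Prod>k<p j. LINT x|lborel. f j k x)"
    unfolding euclid_def
    by (intro prod.cong refl
        product_sigma_finite.product_integral_prod[OF product_sigma_finite_lborel])
       (use f in auto)
  finally show "(LINT t|block_space d p. (\<Prod>j<d. \<Prod>k<p j. f j k (t j k)))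
        = (\<Prod>j<d. \<Prod>k<p j. LINT x|lborel. f j k x)" .
qed

text \<open>The squared norm and the phase are both sums over the coordinates, so the integrand is a
  product of one-dimensional ones.\<close>

lemma
  assumes r: "r > 0"
  shows integrable_block_gaussian:
      "integrable (block_space d p)
        (\<lambda>t. complex_of_real (exp (- (r\<^sup>2 * block_inner d p t t))) * iexp (block_inner d p t z))"
      (is "integrable _ ?g")
    and integral_block_gaussian:
      "(LINT t|block_space d p.
          complex_of_real (exp (- (r\<^sup>2 * block_inner d p t t))) * iexp (block_inner d p t z))
        = complex_of_real ((sqrt pi / r) ^ (\<Sum>j<d. p j) * exp (- (block_inner d p z z / (4 * r\<^sup>2))))"
proof -
  let ?f = "\<lambda>j k x. complex_of_real (exp (- (r\<^sup>2 * x\<^sup>2))) * iexp (x * z j k)"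
  have g: "?g = (\<lambda>t. \<Prod>j<d. \<Prod>k<p j. ?f j k (t j k))"
    by (intro ext)
       (simp add: block_inner_def euclid_inner_def prod.distrib exp_sum[symmetric]
         sum_negf sum_distrib_left power2_eq_square flip: of_real_prod)
  show "integrable (block_space d p) ?g"
    unfolding g by (rule integrable_block_space_prod) (rule gaussian_Fourier(1)[OF r])
  have "(LINT t|block_space d p. ?g t)
      = (\<Prod>j<d. \<Prod>k<p j. complex_of_real (sqrt pi / r * exp (- ((z j k)\<^sup>2 / (4 * r\<^sup>2)))))"
    unfolding g
    by (subst integral_block_space_prod) (auto simp only: gaussian_Fourier[OF r])
  also have "\<dots> = complex_of_real ((\<Prod>j<d. \<Prod>k<p j. sqrt pi / r) *
      (\<Prod>j<d. \<Prod>k<p j. exp (- ((z j k)\<^sup>2 / (4 * r\<^sup>2)))))"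
    by (simp only: prod.distrib of_real_prod[symmetric])
  also have "(\<Prod>j<d. \<Prod>k<p j. sqrt pi / r) = (sqrt pi / r) ^ (\<Sum>j<d. p j)"
    by (simp add: power_sum)
  also have "(\<Prod>j<d. \<Prod>k<p j. exp (- ((z j k)\<^sup>2 / (4 * r\<^sup>2))))
      = exp (- (block_inner d p z z / (4 * r\<^sup>2)))"
    by (simp add: exp_sum[symmetric] block_inner_def euclid_inner_def sum_negf
        sum_divide_distrib power2_eq_square)
  finally show "(LINT t|block_space d p. ?g t)
      = complex_of_real ((sqrt pi / r) ^ (\<Sum>j<d. p j) * exp (- (block_inner d p z z / (4 * r\<^sup>2))))" .
qed

text \<open>The Gaussian transform at \<open>0\<close> minus the one at \<open>z\<close>, real parts
  only. The form is that of a nonnegative integral because it becomes the inner integral in two uses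
  of Tonelli: one for the weight, one for Gaussian convolutions.\<close>

lemma nn_integral_block_gaussian_one_minus_cos:
  assumes r: "r > 0"
  shows "(\<integral>\<^sup>+t. ennreal (exp (- (r\<^sup>2 * block_inner d p t t)) * (1 - cos (block_inner d p t z)))
      \<partial>block_space d p)
    = ennreal ((sqrt pi / r) ^ (\<Sum>j<d. p j) * (1 - exp (- (block_inner d p z z / (4 * r\<^sup>2)))))"
proof -
  let ?e = "\<lambda>t. exp (- (r\<^sup>2 * block_inner d p t t))"
  let ?C = "(sqrt pi / r) ^ (\<Sum>j<d. p j)"
  have Re: "Re (complex_of_real (?e t) * iexp (block_inner d p t z)) = ?e t * cos (block_inner d p t z)"
    for t z by (simp add: Re_exp)
  have int: "integrable (block_space d p) (\<lambda>t. ?e t * cos (block_inner d p t z))" for z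
    using integrable_Re[OF integrable_block_gaussian[OF r, of d p z]] unfolding Re .
  have eq: "(LINT t|block_space d p. ?e t * cos (block_inner d p t z))
      = ?C * exp (- (block_inner d p z z / (4 * r\<^sup>2)))" for z
    using integral_Re[OF integrable_block_gaussian[OF r, of d p z]]
    unfolding Re integral_block_gaussian[OF r] by simp
  have zero: "block_inner d p t (\<lambda>j k. 0) = 0" for t
    by (simp add: block_inner_def euclid_inner_def)
  have int0: "integrable (block_space d p) ?e" and eq0: "(LINT t|block_space d p. ?e t) = ?C"
    using int[of "\<lambda>j k. 0"] eq[of "\<lambda>j k. 0"] by (simp_all add: zero)
  have "(\<integral>\<^sup>+t. ennreal (?e t * (1 - cos (block_inner d p t z))) \<partial>block_space d p)
      = ennreal (LINT t|block_space d p. ?e t * (1 - cos (block_inner d p t z)))"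
    by (rule nn_integral_eq_integral) (use int int0 in \<open>auto simp: right_diff_distrib\<close>)
  also have "(LINT t|block_space d p. ?e t * (1 - cos (block_inner d p t z)))
      = ?C * (1 - exp (- (block_inner d p z z / (4 * r\<^sup>2))))"
    by (simp add: right_diff_distrib int int0 eq eq0)
  finally show ?thesis .
qed

section \<open>The constant of the weight and the weighted integral of
  \<open>1 - cos\<close>\<close>

lemma K_const_pos: "K_const n > 0"
  unfolding K_const_def by (intro divide_pos_pos mult_pos_pos Gamma_real_pos) auto

text \<open>Powers of \<open>sqrt pi\<close> are the form in which the constant meets the Gaussian
  integrals, where each coordinate contributes one factor \<open>sqrt pi\<close>.\<close>

lemma K_const_eq: "K_const n = sqrt pi ^ n * sqrt pi / Gamma ((real n + 1) / 2)"
proof -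
  have "sqrt pi ^ n = pi powr (real n / 2)"
    by (simp add: powr_half_sqrt[symmetric] powr_powr powr_realpow[symmetric])
  then show ?thesis
    by (simp add: K_const_def Gamma_one_half_real)
qed

lemma weight_nonneg: "weight d p t \<ge> 0"
  unfolding weight_def using K_const_pos[of "\<Sum>j<d. p j"] block_norm_nonneg[of d p t]
  by auto

text \<open>Writing \<open>|t|\<close> to the power \<open>- (n + 1)\<close> as a mixture of Gaussians in \<open>t\<close> reduces the integral
  to Gaussian Fourier transforms, so no rotation invariance is needed.\<close>
lemma nn_integral_one_minus_cos_weight:
  "(\<integral>\<^sup>+t. ennreal ((1 - cos (block_inner d p t z)) * weight d p t) \<partial>block_space d p)
    = ennreal (block_norm d p z)"
proof -
  define n where "n = (\<Sum>j<d. p j)"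
  \<comment> \<open>\<open>c\<close> is the quotient of \<open>1 / K_const n\<close> by the Gaussian
    moment \<open>Gamma ((n + 1) / 2) / 2\<close>; the Gamma factors cancel. In the other order of
    integration the same \<open>c\<close> cancels \<open>sqrt pi ^ n * (sqrt pi / 2)\<close>, which
    is exactly why \<open>K_const\<close> normalises the result to the norm.\<close>
  define c where "c = 2 / (sqrt pi ^ n * sqrt pi)"
  let ?i = "\<lambda>t. block_inner d p t z"
  define h where "h t r = ennreal (indicator {0<..} r * (r ^ n * exp (- (r\<^sup>2 * block_inner d p t t)))
    * (1 - cos (?i t)))" for t r
  note [measurable] = borel_measurable_block_inner_self[OF measurable_fst]
    borel_measurable_block_inner_right[OF measurable_fst]
  have h_meas: "case_prod h \<in> borel_measurable (block_space d p \<Otimes>\<^sub>M lborel)"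
    unfolding h_def case_prod_beta by measurable
  interpret pair_sigma_finite "block_space d p" lborel
    unfolding pair_sigma_finite_def
    by (simp add: sigma_finite_block_space lborel.sigma_finite_measure_axioms)
  have c: "c > 0" unfolding c_def by simp
  have alg: "2 / A * (G / (2 * S) * q) = q * (1 / (A / G * S))" for A G S q :: real
    by (simp add: field_simps)
  have inner_r: "ennreal ((1 - cos (?i t)) * weight d p t) = ennreal c * (\<integral>\<^sup>+r. h t r \<partial>lborel)" for t
  \<comment> \<open>At norm \<open>0\<close> the moment in \<open>r\<close> diverges, but
    \<open>1 - cos\<close> vanishes and \<open>h\<close> multiplies the two before integrating, so
    both sides are \<open>0\<close>.\<close>
  proof (cases "block_norm d p t = 0")
    case True
    then show ?thesis by (simp add: h_def block_inner_norm_0)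
  next
    case False
    define s where "s = block_norm d p t"
    have s: "s > 0" using False block_norm_nonneg[of d p t] by (simp add: s_def)
    have "(\<integral>\<^sup>+r. h t r \<partial>lborel) = (\<integral>\<^sup>+r. ennreal (indicator {0<..} r * (r ^ n * exp (- (r\<^sup>2 * s\<^sup>2))))
        * ennreal (1 - cos (?i t)) \<partial>lborel)"
      by (intro nn_integral_cong)
         (auto simp: h_def s_def block_norm_power2 indicator_def simp flip: ennreal_mult')
    also have "\<dots> = ennreal (Gamma ((real n + 1) / 2) / (2 * s ^ (n + 1))) * ennreal (1 - cos (?i t))"
      by (subst nn_integral_multc) (auto simp only: nn_integral_gaussian_moment_scaled[OF s], measurable)
    finally have eq: "(\<integral>\<^sup>+r. h t r \<partial>lborel) = \<dots>" .
    have "0 < Gamma ((real n + 1) / 2)"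
      by (rule Gamma_real_pos) simp
    then have G: "0 \<le> Gamma ((real n + 1) / 2) / (2 * s ^ (n + 1))"
      using s by simp
    have "ennreal c * (\<integral>\<^sup>+r. h t r \<partial>lborel)
        = ennreal (c * (Gamma ((real n + 1) / 2) / (2 * s ^ (n + 1)) * (1 - cos (?i t))))"
      unfolding eq using c by (simp only: ennreal_mult'[OF G] ennreal_mult'[OF less_imp_le])
    also have "c * (Gamma ((real n + 1) / 2) / (2 * s ^ (n + 1)) * (1 - cos (?i t)))
        = (1 - cos (?i t)) * weight d p t"
      unfolding weight_def n_def[symmetric] s_def[symmetric] K_const_eq c_def by (rule alg)
    finally show ?thesis by simp
  qed
  have inner_t: "(\<integral>\<^sup>+t. h t r \<partial>block_space d p) = ennreal (sqrt pi ^ n) *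
      ennreal (indicator {0<..} r * (1 - exp (- ((block_norm d p z)\<^sup>2 / (4 * r\<^sup>2)))))" for r
  proof (cases "r > 0")
    case True
    have "(\<integral>\<^sup>+t. h t r \<partial>block_space d p) = (\<integral>\<^sup>+t. ennreal (r ^ n) *
        ennreal (exp (- (r\<^sup>2 * block_inner d p t t)) * (1 - cos (?i t))) \<partial>block_space d p)"
      by (intro nn_integral_cong) (use True in \<open>simp add: h_def mult_ac flip: ennreal_mult'\<close>)
    also have "\<dots> = ennreal (r ^ n) *
        ennreal ((sqrt pi / r) ^ n * (1 - exp (- (block_inner d p z z / (4 * r\<^sup>2)))))"
      unfolding n_def nn_integral_block_gaussian_one_minus_cos[OF True, symmetric]
      by (rule nn_integral_cmult) measurable
    also have "\<dots> = ennreal (r ^ n * ((sqrt pi / r) ^ n * (1 - exp (- (block_inner d p z z / (4 * r\<^sup>2))))))"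
      using True by (simp add: ennreal_mult')
    also have "r ^ n * ((sqrt pi / r) ^ n * (1 - exp (- (block_inner d p z z / (4 * r\<^sup>2)))))
        = sqrt pi ^ n * (1 - exp (- (block_inner d p z z / (4 * r\<^sup>2))))"
      using True by (simp add: power_divide)
    finally show ?thesis
      using True by (simp add: ennreal_mult' block_norm_power2)
  qed (simp add: h_def)
  have "(\<integral>\<^sup>+t. ennreal ((1 - cos (?i t)) * weight d p t) \<partial>block_space d p)
      = ennreal c * (\<integral>\<^sup>+t. \<integral>\<^sup>+r. h t r \<partial>lborel \<partial>block_space d p)"
    unfolding inner_r
    by (rule nn_integral_cmult) (rule lborel.borel_measurable_nn_integral, rule h_meas)
  also have "(\<integral>\<^sup>+t. \<integral>\<^sup>+r. h t r \<partial>lborel \<partial>block_space d p) = (\<integral>\<^sup>+r. \<integral>\<^sup>+t. h t r \<partial>block_space d p \<partial>lborel)"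
    by (rule Fubini'[symmetric]) (rule h_meas)
  also have "\<dots> = ennreal (sqrt pi ^ n) * ennreal (block_norm d p z * sqrt pi / 2)"
    unfolding inner_t nn_integral_one_minus_gaussian[OF block_norm_nonneg, symmetric]
    by (rule nn_integral_cmult) measurable
  also have "ennreal c * \<dots> = ennreal (c * (sqrt pi ^ n * (block_norm d p z * sqrt pi / 2)))"
    using c by (simp only: ennreal_mult'[symmetric] less_imp_le zero_le_power real_sqrt_ge_zero pi_ge_zero)
  also have "c * (sqrt pi ^ n * (block_norm d p z * sqrt pi / 2)) = block_norm d p z"
    by (simp add: c_def)
  finally show ?thesis .
qed

section \<open>The energy identity\<close>

text \<open>It depends on a law rather than on a random vector, so that the joint and the product
  characteristic function become two instances of one notion.\<close>

definition Fourier :: "nat \<Rightarrow> (nat \<Rightarrow> nat) \<Rightarrow> (nat \<Rightarrow> nat \<Rightarrow> real) measure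
    \<Rightarrow> (nat \<Rightarrow> nat \<Rightarrow> real) \<Rightarrow> complex" where
  "Fourier d p \<mu> t = (LINT x|\<mu>. iexp (block_inner d p t x))"

text \<open>Values in \<open>[0, \<infinity>]\<close> allow the energy identity to be proved before
  any moment is known to be finite.\<close>

definition mean_dist :: "nat \<Rightarrow> (nat \<Rightarrow> nat) \<Rightarrow> (nat \<Rightarrow> nat \<Rightarrow> real) measure
    \<Rightarrow> (nat \<Rightarrow> nat \<Rightarrow> real) measure \<Rightarrow> ennreal" where
  "mean_dist d p \<mu> \<nu> = (\<integral>\<^sup>+x. \<integral>\<^sup>+y. ennreal (block_dist d p x y) \<partial>\<nu> \<partial>\<mu>)"

text \<open>Only the sigma-algebra is prescribed, so that the law of a random vector and a product
  of marginals are instances on equal terms.\<close>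

locale block_prob = prob_space \<mu> for \<mu> :: "(nat \<Rightarrow> nat \<Rightarrow> real) measure" +
  fixes d :: nat and p :: "nat \<Rightarrow> nat"
  assumes sets_eq [measurable_cong]: "sets \<mu> = sets (block_space d p)"
begin

lemma measurable_id_block_space: "(\<lambda>x. x) \<in> measurable \<mu> (block_space d p)"
  by (rule measurable_ident_sets[OF sets_eq])

lemma measurable_inner [measurable]: "(\<lambda>x. block_inner d p t x) \<in> borel_measurable \<mu>"
  by (rule borel_measurable_block_inner_left[OF measurable_id_block_space])

lemma integrable_iexp: "integrable \<mu> (\<lambda>x. iexp (block_inner d p t x))"
  by (rule integrable_const_bound[where B = 1]) auto

lemma integrable_cos_sin:
  "integrable \<mu> (\<lambda>x. cos (block_inner d p t x))" "integrable \<mu> (\<lambda>x. sin (block_inner d p t x))"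
  by (rule integrable_const_bound[where B = 1]; auto)+

lemma Re_Fourier: "Re (Fourier d p \<mu> t) = (LINT x|\<mu>. cos (block_inner d p t x))"
  unfolding Fourier_def
  by (subst integral_Re[OF integrable_iexp, symmetric]) (simp add: Re_exp)

lemma Im_Fourier: "Im (Fourier d p \<mu> t) = (LINT x|\<mu>. sin (block_inner d p t x))"
  unfolding Fourier_def
  by (subst integral_Im[OF integrable_iexp, symmetric]) (simp add: Im_exp)

text \<open>The addition theorem for \<open>cos\<close> separates \<open>x\<close> from
  \<open>y\<close>, so the integral over \<open>y\<close> sees the law only through the real and
  imaginary parts of its transform. Nonnegativity is recorded because \<open>ennreal\<close>
  truncates negative reals, which would spoil later products.\<close>

lemma
  shows nn_integral_one_minus_cos_diff:
    "(\<integral>\<^sup>+y. ennreal (1 - cos (block_inner d p t (\<lambda>j k. x j k - y j k))) \<partial>\<mu>)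
      = ennreal (1 - (cos (block_inner d p t x) * Re (Fourier d p \<mu> t)
        + sin (block_inner d p t x) * Im (Fourier d p \<mu> t)))"
      (is "?l = ennreal ?r")
    and one_minus_cos_diff_nonneg:
    "0 \<le> 1 - (cos (block_inner d p t x) * Re (Fourier d p \<mu> t)
        + sin (block_inner d p t x) * Im (Fourier d p \<mu> t))"
proof -
  let ?f = "\<lambda>y. 1 - cos (block_inner d p t (\<lambda>j k. x j k - y j k))"
  have f: "?f = (\<lambda>y. 1 - (cos (block_inner d p t x) * cos (block_inner d p t y)
      + sin (block_inner d p t x) * sin (block_inner d p t y)))"
    by (simp add: block_inner_diff cos_diff)
  have int: "integrable \<mu> ?f"
    unfolding f using integrable_cos_sin[of t] by auto
  have eq: "(LINT y|\<mu>. ?f y) = ?r"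
    unfolding f Re_Fourier Im_Fourier using integrable_cos_sin[of t] by (simp add: prob_space)
  show "?l = ennreal ?r"
    unfolding eq[symmetric] by (rule nn_integral_eq_integral[OF int]) auto
  show "0 \<le> ?r"
    unfolding eq[symmetric] by (rule Bochner_Integration.integral_nonneg) auto
qed

lemma measurable_Fourier [measurable]: "Fourier d p \<mu> \<in> borel_measurable (block_space d p)"
proof -
  have [measurable]: "(\<lambda>w. block_inner d p (fst w) (snd w))
      \<in> borel_measurable (block_space d p \<Otimes>\<^sub>M \<mu>)"
    by (rule borel_measurable_block_inner; rule measurable_coordinate) measurable
  show ?thesis
    unfolding Fourier_def by measurable
qed

end

locale block_prob_pair = \<mu>: block_prob \<mu> d p + \<nu>: block_prob \<nu> d p
  for \<mu> \<nu> :: "(nat \<Rightarrow> nat \<Rightarrow> real) measure" and d p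
begin

text \<open>The bracket is the real part of one transform times the conjugate of the other.\<close>

lemma
  shows nn_integral_one_minus_cos_diff2:
    "(\<integral>\<^sup>+x. \<integral>\<^sup>+y. ennreal (1 - cos (block_inner d p t (\<lambda>j k. x j k - y j k))) \<partial>\<nu> \<partial>\<mu>)
      = ennreal (1 - (Re (Fourier d p \<mu> t) * Re (Fourier d p \<nu> t)
        + Im (Fourier d p \<mu> t) * Im (Fourier d p \<nu> t)))"
      (is "?l = ennreal ?r")
    and one_minus_cos_diff2_nonneg:
    "0 \<le> 1 - (Re (Fourier d p \<mu> t) * Re (Fourier d p \<nu> t)
        + Im (Fourier d p \<mu> t) * Im (Fourier d p \<nu> t))"
proof -
  let ?f = "\<lambda>x. 1 - (cos (block_inner d p t x) * Re (Fourier d p \<nu> t)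
        + sin (block_inner d p t x) * Im (Fourier d p \<nu> t))"
  have int: "integrable \<mu> ?f"
    using \<mu>.integrable_cos_sin[of t] by auto
  have eq: "(LINT x|\<mu>. ?f x) = ?r"
    unfolding \<mu>.Re_Fourier \<mu>.Im_Fourier using \<mu>.integrable_cos_sin[of t]
    by (simp add: \<mu>.prob_space)
  show "?l = ennreal ?r"
    unfolding eq[symmetric] \<nu>.nn_integral_one_minus_cos_diff
    by (rule nn_integral_eq_integral[OF int]) (rule AE_I2, rule \<nu>.one_minus_cos_diff_nonneg)
  show "0 \<le> ?r"
    unfolding eq[symmetric] by (rule Bochner_Integration.integral_nonneg) (rule \<nu>.one_minus_cos_diff_nonneg)
qed

text \<open>Tonelli for \<open>t\<close> against the pair \<open>(x, y)\<close>: for fixed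
  \<open>t\<close> the pair integrates to the bracket of transforms, for fixed \<open>(x, y)\<close>
  the weighted integral over \<open>t\<close> is the distance.\<close>

lemma nn_integral_mean_dist:
  "(\<integral>\<^sup>+t. ennreal ((1 - (Re (Fourier d p \<mu> t) * Re (Fourier d p \<nu> t)
        + Im (Fourier d p \<mu> t) * Im (Fourier d p \<nu> t))) * weight d p t) \<partial>block_space d p)
    = mean_dist d p \<mu> \<nu>"
proof -
  define g where "g t w = ennreal (1 - cos (block_inner d p t (\<lambda>j k. fst w j k - snd w j k)))"
    for t w
  define h where "h t w = ennreal ((1 - cos (block_inner d p t (\<lambda>j k. fst w j k - snd w j k)))
    * weight d p t)" for t w
  interpret P: pair_prob_space \<mu> \<nu> ..
  interpret Q: pair_sigma_finite "block_space d p" "\<mu> \<Otimes>\<^sub>M \<nu>"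
    unfolding pair_sigma_finite_def
    by (simp add: sigma_finite_block_space P.sigma_finite_measure_axioms)
  have coord: "(\<lambda>z. fst z) \<in> measurable (block_space d p \<Otimes>\<^sub>M (\<mu> \<Otimes>\<^sub>M \<nu>)) (block_space d p)"
    "(\<lambda>z. fst (snd z)) \<in> measurable (block_space d p \<Otimes>\<^sub>M (\<mu> \<Otimes>\<^sub>M \<nu>)) (block_space d p)"
    "(\<lambda>z. snd (snd z)) \<in> measurable (block_space d p \<Otimes>\<^sub>M (\<mu> \<Otimes>\<^sub>M \<nu>)) (block_space d p)"
    by measurable
  have i1[measurable]: "(\<lambda>z. block_inner d p (fst z) (\<lambda>j k. fst (snd z) j k - snd (snd z) j k))
      \<in> borel_measurable (block_space d p \<Otimes>\<^sub>M (\<mu> \<Otimes>\<^sub>M \<nu>))"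
    by (rule borel_measurable_block_inner)
       (auto intro: borel_measurable_diff measurable_coordinate[OF coord(1)]
         measurable_coordinate[OF coord(2)] measurable_coordinate[OF coord(3)])
  have h_meas: "case_prod h \<in> borel_measurable (block_space d p \<Otimes>\<^sub>M (\<mu> \<Otimes>\<^sub>M \<nu>))"
    unfolding h_def case_prod_beta by measurable
  have coord2: "fst \<in> measurable (\<mu> \<Otimes>\<^sub>M \<nu>) (block_space d p)"
    "snd \<in> measurable (\<mu> \<Otimes>\<^sub>M \<nu>) (block_space d p)"
    by measurable
  have i2[measurable]: "(\<lambda>z. block_inner d p t (\<lambda>j k. fst z j k - snd z j k))
      \<in> borel_measurable (\<mu> \<Otimes>\<^sub>M \<nu>)" for t
    by (rule borel_measurable_block_inner)
       (auto intro: borel_measurable_diff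
         measurable_coordinate[OF coord2(1)] measurable_coordinate[OF coord2(2)])
  have g_meas[measurable]: "g t \<in> borel_measurable (\<mu> \<Otimes>\<^sub>M \<nu>)" for t
    unfolding g_def by measurable
  have d_meas: "(\<lambda>w. ennreal (block_norm d p (\<lambda>j k. fst w j k - snd w j k))) \<in> borel_measurable (\<mu> \<Otimes>\<^sub>M \<nu>)"
    using borel_measurable_block_dist[OF coord2] unfolding block_dist_def by measurable
  have D: "ennreal ((1 - (Re (Fourier d p \<mu> t) * Re (Fourier d p \<nu> t)
        + Im (Fourier d p \<mu> t) * Im (Fourier d p \<nu> t))) * weight d p t)
      = (\<integral>\<^sup>+w. h t w \<partial>(\<mu> \<Otimes>\<^sub>M \<nu>))" for t
  proof -
    have "(\<integral>\<^sup>+w. h t w \<partial>(\<mu> \<Otimes>\<^sub>M \<nu>)) = (\<integral>\<^sup>+w. g t w * ennreal (weight d p t) \<partial>(\<mu> \<Otimes>\<^sub>M \<nu>))"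
      unfolding h_def g_def by (intro nn_integral_cong ennreal_mult) (auto simp: weight_nonneg)
    also have "\<dots> = (\<integral>\<^sup>+w. g t w \<partial>(\<mu> \<Otimes>\<^sub>M \<nu>)) * ennreal (weight d p t)"
      by (rule nn_integral_multc) (rule g_meas)
    also have "(\<integral>\<^sup>+w. g t w \<partial>(\<mu> \<Otimes>\<^sub>M \<nu>)) = (\<integral>\<^sup>+x. \<integral>\<^sup>+y. g t (x, y) \<partial>\<nu> \<partial>\<mu>)"
      by (rule \<nu>.nn_integral_fst[symmetric]) (rule g_meas)
    also have "\<dots> = ennreal (1 - (Re (Fourier d p \<mu> t) * Re (Fourier d p \<nu> t)
        + Im (Fourier d p \<mu> t) * Im (Fourier d p \<nu> t)))"
      unfolding g_def fst_conv snd_conv by (rule nn_integral_one_minus_cos_diff2)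
    finally show ?thesis
      by (simp only: ennreal_mult'[OF one_minus_cos_diff2_nonneg])
  qed
  have "(\<integral>\<^sup>+t. \<integral>\<^sup>+w. h t w \<partial>(\<mu> \<Otimes>\<^sub>M \<nu>) \<partial>block_space d p)
      = (\<integral>\<^sup>+w. \<integral>\<^sup>+t. h t w \<partial>block_space d p \<partial>(\<mu> \<Otimes>\<^sub>M \<nu>))"
    by (rule Q.Fubini'[symmetric]) (rule h_meas)
  also have "\<dots> = (\<integral>\<^sup>+w. ennreal (block_norm d p (\<lambda>j k. fst w j k - snd w j k)) \<partial>(\<mu> \<Otimes>\<^sub>M \<nu>))"
    unfolding h_def nn_integral_one_minus_cos_weight ..
  also have "\<dots> = mean_dist d p \<mu> \<nu>"
    unfolding mean_dist_def block_dist_def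
    by (subst \<nu>.nn_integral_fst[symmetric]) (rule d_meas, simp)
  finally show ?thesis
    unfolding D .
qed

end

lemma (in block_prob) block_prob_pair_self: "block_prob_pair \<mu> \<mu> d p"
  by (simp add: block_prob_pair_def block_prob_axioms)

context block_prob_pair
begin

text \<open>The diagonal terms stay on the left since subtraction in \<open>ennreal\<close> is
  truncated; in this form the identity also holds when mean distances are infinite.\<close>

lemma energy_identity:
  "(\<integral>\<^sup>+t. ennreal ((cmod (Fourier d p \<mu> t - Fourier d p \<nu> t))\<^sup>2 * weight d p t) \<partial>block_space d p)
      + mean_dist d p \<mu> \<mu> + mean_dist d p \<nu> \<nu>
    = 2 * mean_dist d p \<mu> \<nu>"
proof -
  interpret \<mu>\<mu>: block_prob_pair \<mu> \<mu> d p by (rule \<mu>.block_prob_pair_self)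
  interpret \<nu>\<nu>: block_prob_pair \<nu> \<nu> d p by (rule \<nu>.block_prob_pair_self)
  let ?D = "\<lambda>\<mu> \<nu> t. (1 - (Re (Fourier d p \<mu> t) * Re (Fourier d p \<nu> t)
        + Im (Fourier d p \<mu> t) * Im (Fourier d p \<nu> t))) * weight d p t"
  let ?q = "\<lambda>t. (cmod (Fourier d p \<mu> t - Fourier d p \<nu> t))\<^sup>2 * weight d p t"
  have "(\<integral>\<^sup>+t. ennreal (?q t) \<partial>block_space d p) + mean_dist d p \<mu> \<mu> + mean_dist d p \<nu> \<nu>
      = (\<integral>\<^sup>+t. ennreal (?q t) + ennreal (?D \<mu> \<mu> t) + ennreal (?D \<nu> \<nu> t) \<partial>block_space d p)"
    unfolding \<mu>\<mu>.nn_integral_mean_dist[symmetric] \<nu>\<nu>.nn_integral_mean_dist[symmetric]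
    by (subst nn_integral_add; (subst nn_integral_add)?; measurable)
  also have "\<dots> = (\<integral>\<^sup>+t. 2 * ennreal (?D \<mu> \<nu> t) \<partial>block_space d p)"
  proof (rule nn_integral_cong)
    fix t
    have nonneg: "0 \<le> ?q t" "0 \<le> ?D \<mu> \<mu> t" "0 \<le> ?D \<nu> \<nu> t" "0 \<le> ?D \<mu> \<nu> t"
      using \<mu>\<mu>.one_minus_cos_diff2_nonneg[of t] \<nu>\<nu>.one_minus_cos_diff2_nonneg[of t]
        one_minus_cos_diff2_nonneg[of t] weight_nonneg[of d p t] by (auto intro!: mult_nonneg_nonneg)
    \<comment> \<open>With \<open>a\<close> and \<open>b\<close> the two transforms at
      \<open>t\<close>, this expands the square of \<open>|a - b|\<close>: the diagonal terms
      \<open>1 - |a|^2\<close> and \<open>1 - |b|^2\<close> cancel the squares, leaving twice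
      \<open>1\<close> minus the real part of \<open>a\<close> times the conjugate of
      \<open>b\<close>.\<close>
    have "?q t + ?D \<mu> \<mu> t + ?D \<nu> \<nu> t = 2 * ?D \<mu> \<nu> t"
      unfolding cmod_power2 by (simp add: algebra_simps power2_eq_square)
    then have "ennreal (?q t + ?D \<mu> \<mu> t + ?D \<nu> \<nu> t) = ennreal (2 * ?D \<mu> \<nu> t)"
      by (rule arg_cong)
    then show "ennreal (?q t) + ennreal (?D \<mu> \<mu> t) + ennreal (?D \<nu> \<nu> t) = 2 * ennreal (?D \<mu> \<nu> t)"
      using nonneg by (simp only: ennreal_plus add_nonneg_nonneg ennreal_mult' ennreal_numeral zero_le_numeral)
  qed
  also have "\<dots> = 2 * mean_dist d p \<mu> \<nu>"
    unfolding nn_integral_mean_dist[symmetric] by (rule nn_integral_cmult) measurable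
  finally show ?thesis .
qed

end

section \<open>Uniqueness of the characteristic function\<close>

text \<open>Such boxes are closed under intersection, by taking minima of corners, and their
  indicators are products over the coordinates, which suits smoothing by isotropic
  Gaussians.\<close>

definition lower_box :: "nat \<Rightarrow> (nat \<Rightarrow> nat) \<Rightarrow> (nat \<Rightarrow> nat \<Rightarrow> real) \<Rightarrow> (nat \<Rightarrow> nat \<Rightarrow> real) set" where
  "lower_box d p a = {x \<in> space (block_space d p). \<forall>j<d. \<forall>k<p j. x j k \<le> a j k}"

lemma abs_coordinate_le_norm:
  assumes "j < d" "k < p j"
  shows "\<bar>x j k\<bar> \<le> block_norm d p x"
proof -
  have "x j k * x j k \<le> (\<Sum>k<p j. x j k * x j k)"
    by (rule member_le_sum) (use assms in auto)
  also have "\<dots> \<le> (\<Sum>j<d. \<Sum>k<p j. x j k * x j k)"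
    by (rule member_le_sum) (use assms in \<open>auto intro: sum_nonneg\<close>)
  finally have "(x j k)\<^sup>2 \<le> (block_norm d p x)\<^sup>2"
    unfolding block_norm_power2 by (simp add: block_inner_def euclid_inner_def power2_eq_square)
  then show ?thesis
    using block_norm_nonneg[of d p x] abs_le_square_iff[of "x j k" "block_norm d p x"] by simp
qed

lemma Int_stable_range_lower_box: "Int_stable (range (lower_box d p))"
proof (rule Int_stableI_image)
  fix a b :: "nat \<Rightarrow> nat \<Rightarrow> real"
  show "\<exists>c\<in>UNIV. lower_box d p a \<inter> lower_box d p b = lower_box d p c"
    by (intro bexI[of _ "\<lambda>j k. min (a j k) (b j k)"]) (auto simp: lower_box_def)
qed

lemma UN_lower_box: "(\<Union>n. lower_box d p (\<lambda>j k. real n)) = space (block_space d p)"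
proof -
  have "\<exists>n. \<forall>j<d. \<forall>k<p j. x j k \<le> real n" for x
  proof -
    obtain n where n: "block_norm d p x \<le> real n" using real_arch_simple by blast
    have "x j k \<le> real n" if "j < d" "k < p j" for j k
      using abs_coordinate_le_norm[of j d k p x] n that by linarith
    then show ?thesis by blast
  qed
  then show ?thesis by (auto simp: lower_box_def)
qed

lemma lower_box_in_sets: "lower_box d p a \<in> sets (block_space d p)"
proof -
  have "lower_box d p a = {x \<in> space (block_space d p). \<forall>j\<in>{..<d}. \<forall>k\<in>{..<p j}. x j k \<le> a j k}"
    by (auto simp: lower_box_def)
  also have "\<dots> \<in> sets (block_space d p)"
    by (intro sets.sets_Collect_finite_All borel_measurable_le[OF measurable_coordinate])
       (auto intro: measurable_ident_sets)
  finally show ?thesis .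
qed

text \<open>The substantial half is that boxes generate enough sets. The identity from the generated
  sigma-algebra \<open>N\<close> into the nested product is measurable once all coordinates are; the
  product criterion is applied twice, to the coordinates of a block and to the blocks.\<close>

lemma sets_block_space_eq_lower_box:
  "sets (block_space d p) = sigma_sets (space (block_space d p)) (range (lower_box d p))"
proof (rule antisym)
  let ?\<Omega> = "space (block_space d p)"
  define N where "N = sigma ?\<Omega> (range (lower_box d p))"
  have sub: "range (lower_box d p) \<subseteq> Pow ?\<Omega>" by (auto simp: lower_box_def)
  have space_N: "space N = ?\<Omega>" and sets_N: "sets N = sigma_sets ?\<Omega> (range (lower_box d p))"
    using sub by (simp_all add: N_def space_measure_of sets_measure_of)
  have half: "{w \<in> space N. w j k \<le> c} \<in> sets N" if jk: "j < d" "k < p j" for j k c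
  proof -
    \<comment> \<open>The bound is \<open>c\<close> at one coordinate and \<open>n\<close> at all
      others; letting \<open>n\<close> grow exhausts the half-space by countably many boxes.\<close>
    let ?B = "\<lambda>n::nat. lower_box d p (\<lambda>j' k'. if j' = j \<and> k' = k then c else real n)"
    have "{w \<in> space N. w j k \<le> c} = (\<Union>n. ?B n)"
    proof (intro antisym subsetI)
      fix w assume w: "w \<in> {w \<in> space N. w j k \<le> c}"
      then obtain n where "w \<in> lower_box d p (\<lambda>j k. real n)"
        using UN_lower_box[of d p] by (auto simp: space_N)
      then have "w \<in> ?B n" using w by (auto simp: lower_box_def)
      then show "w \<in> (\<Union>n. ?B n)" by blast
    next
      fix w assume "w \<in> (\<Union>n. ?B n)"
      then show "w \<in> {w \<in> space N. w j k \<le> c}"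
        using jk by (auto simp: lower_box_def space_N split: if_splits)
    qed
    also have "\<dots> \<in> sets N"
      unfolding sets_N by (rule sigma_sets.Union) (auto intro: sigma_sets.Basic)
    finally show ?thesis .
  qed
  have coord: "(\<lambda>w. w j k) \<in> borel_measurable N" if "j < d" "k < p j" for j k
    unfolding borel_measurable_iff_le using half[OF that] by blast
  have ext: "w \<in> (\<Pi>\<^sub>E j\<in>{..<d}. \<Pi>\<^sub>E k\<in>{..<p j}. UNIV)" if "w \<in> space N" for w
    using that unfolding space_N by (simp add: block_space_def euclid_def space_PiM)
  have block: "(\<lambda>w. w j) \<in> measurable N (euclid (p j))" if "j < d" for j
    unfolding euclid_def
    by (rule measurable_PiM_single') (use that ext coord in \<open>auto simp: PiE_def Pi_def\<close>)
  have id: "(\<lambda>w. w) \<in> measurable N (block_space d p)"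
    unfolding block_space_def
    by (rule measurable_PiM_single') (use ext block in \<open>auto simp: PiE_def Pi_def euclid_def space_PiM\<close>)
  show "sets (block_space d p) \<subseteq> sigma_sets ?\<Omega> (range (lower_box d p))"
  proof
    fix A assume A: "A \<in> sets (block_space d p)"
    then have "(\<lambda>w. w) -` A \<inter> space N \<in> sets N"
      by (rule measurable_sets[OF id])
    moreover have "(\<lambda>w. w) -` A \<inter> space N = A"
      using sets.sets_into_space[OF A] by (auto simp: space_N)
    ultimately show "A \<in> sigma_sets ?\<Omega> (range (lower_box d p))"
      by (simp add: sets_N)
  qed
  show "sigma_sets ?\<Omega> (range (lower_box d p)) \<subseteq> sets (block_space d p)"
    by (rule sets.sigma_sets_subset) (auto simp: lower_box_in_sets)
qed

text \<open>This is \<open>sqrt pi\<close> times the probability that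
  \<open>y + 2 * r * U \<le> b\<close>, where \<open>U\<close> has density
  \<open>exp (- u\<^sup>2) / sqrt pi\<close>: a half-line indicator smoothed by the kernel
  \<open>exp (- x\<^sup>2 / (4 * r\<^sup>2))\<close>, whence the scale \<open>2 * r\<close>. The
  factor \<open>sqrt pi\<close> is carried along and cancelled at the end.\<close>

definition smooth_step :: "real \<Rightarrow> real \<Rightarrow> real \<Rightarrow> real" where
  "smooth_step r b y = (LINT u|lborel. indicator {..b} (y + 2 * r * u) * exp (- u\<^sup>2))"

lemma integral_gaussian:
  "integrable lborel (\<lambda>u::real. exp (- u\<^sup>2))" "(LINT u|lborel. exp (- u\<^sup>2 :: real)) = sqrt pi"
proof -
  show "integrable lborel (\<lambda>u::real. exp (- u\<^sup>2))"
    using integrable_Re[OF gaussian_Fourier(1)[of 1 0]] by simp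
  show "(LINT u|lborel. exp (- u\<^sup>2 :: real)) = sqrt pi"
    using integral_Re[OF gaussian_Fourier(1)[of 1 0]] unfolding gaussian_Fourier(2)[of 1 0, simplified]
    by simp
qed

lemma integrable_smooth_step:
  "integrable lborel (\<lambda>u. indicator {..b} (y + 2 * r * u) * exp (- u\<^sup>2 :: real) :: real)"
  by (rule Bochner_Integration.integrable_bound[OF integral_gaussian(1)]) (auto simp: indicator_def)

lemma smooth_step_bounds: "0 \<le> smooth_step r b y" "smooth_step r b y \<le> sqrt pi"
proof -
  show "0 \<le> smooth_step r b y"
    unfolding smooth_step_def by (rule Bochner_Integration.integral_nonneg) auto
  show "smooth_step r b y \<le> sqrt pi"
    unfolding smooth_step_def integral_gaussian(2)[symmetric]
    by (rule integral_mono[OF integrable_smooth_step integral_gaussian(1)]) (auto simp: indicator_def)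
qed

lemma measurable_smooth_step [measurable]: "smooth_step r b \<in> borel_measurable borel"
proof -
  have "(\<lambda>y. LINT u|lborel. indicator {..b} (y + 2 * r * u) * exp (- u\<^sup>2 :: real) :: real)
      \<in> borel_measurable borel"
    by measurable
  then show ?thesis
    unfolding smooth_step_def .
qed

lemma nn_integral_gaussian_below:
  fixes r b y :: real
  assumes r: "r > 0"
  shows "(\<integral>\<^sup>+x. ennreal (indicator {..b} x * exp (- ((x - y)\<^sup>2 / (4 * r\<^sup>2)))) \<partial>lborel)
    = ennreal (2 * r * smooth_step r b y)"
proof -
  let ?f = "\<lambda>x. ennreal (indicator {..b} x * exp (- ((x - y)\<^sup>2 / (4 * r\<^sup>2))))"
  have "(\<integral>\<^sup>+x. ?f x \<partial>lborel) = ennreal \<bar>2 * r\<bar> * (\<integral>\<^sup>+u. ?f (y + 2 * r * u) \<partial>lborel)"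
    by (rule nn_integral_real_affine) (use r in auto)
  also have "(\<lambda>u. ?f (y + 2 * r * u)) = (\<lambda>u. ennreal (indicator {..b} (y + 2 * r * u) * exp (- u\<^sup>2)))"
    using r by (simp add: power_mult_distrib)
  also have "integral\<^sup>N lborel \<dots> = ennreal (smooth_step r b y)"
    unfolding smooth_step_def by (rule nn_integral_eq_integral[OF integrable_smooth_step]) auto
  finally show ?thesis
    using r by (simp add: ennreal_mult')
qed

text \<open>The threshold exceeds \<open>a\<close> by more than the Gaussian scale, so the limit is the closed
  half-line also at the boundary point \<open>y = a\<close>.\<close>
lemma tendsto_smooth_step:
  "(\<lambda>i. smooth_step ((inverse (real (Suc i)))\<^sup>2) (a + inverse (real (Suc i))) y)
    \<longlonglongrightarrow> indicator {..a} y * sqrt pi"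
proof -
  let ?e = "\<lambda>i. inverse (real (Suc i))"
  let ?f = "\<lambda>i u. indicator {..a + ?e i} (y + 2 * (?e i)\<^sup>2 * u) * exp (- u\<^sup>2 :: real) :: real"
  have e0: "?e \<longlonglongrightarrow> 0" by (rule LIMSEQ_inverse_real_of_nat)
  \<comment> \<open>For fixed \<open>u\<close> the integrand is eventually constant. If
    \<open>y \<le> a\<close>, the shift \<open>2 * (?e i)\<^sup>2 * u\<close> is at most the margin
    \<open>?e i\<close> as soon as \<open>2 * ?e i * u < 1\<close>; otherwise shift and margin both
    vanish against the gap \<open>y - a\<close>.\<close>
  have pt: "(\<lambda>i. ?f i u) \<longlonglongrightarrow> indicator {..a} y * exp (- u\<^sup>2)" for u
  proof (rule tendsto_eventually)
    show "\<forall>\<^sub>F i in sequentially. ?f i u = indicator {..a} y * exp (- u\<^sup>2)"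
    proof (cases "y \<le> a")
      case True
      have "(\<lambda>i. 2 * ?e i * u) \<longlonglongrightarrow> 2 * 0 * u" by (intro tendsto_intros e0)
      then have "\<forall>\<^sub>F i in sequentially. 2 * ?e i * u < 1" by (intro order_tendstoD) auto
      then show ?thesis
      proof eventually_elim
        case (elim i)
        have "y + 2 * (?e i)\<^sup>2 * u = y + ?e i * (2 * ?e i * u)"
          by (simp add: power2_eq_square)
        also have "\<dots> \<le> a + ?e i * 1"
          using True elim by (intro add_mono mult_left_mono) auto
        finally have "y + 2 * (?e i)\<^sup>2 * u \<le> a + ?e i" by simp
        then show ?case using True by simp
      qed
    next
      case False
      have "(\<lambda>i. y + 2 * (?e i)\<^sup>2 * u - (a + ?e i)) \<longlonglongrightarrow> y + 2 * 0\<^sup>2 * u - (a + 0)"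
        by (intro tendsto_intros e0)
      then have "\<forall>\<^sub>F i in sequentially. 0 < y + 2 * (?e i)\<^sup>2 * u - (a + ?e i)"
        using False by (intro order_tendstoD) auto
      then show ?thesis
        by eventually_elim (use False in auto)
    qed
  qed
  have "(\<lambda>i. LINT u|lborel. ?f i u) \<longlonglongrightarrow> (LINT u|lborel. indicator {..a} y * exp (- u\<^sup>2))"
  proof (rule integral_dominated_convergence[where w = "\<lambda>u. exp (- u\<^sup>2)"])
    show "AE u in lborel. (\<lambda>i. ?f i u) \<longlonglongrightarrow> indicator {..a} y * exp (- u\<^sup>2)"
      by (rule AE_I2) (rule pt)
    show "AE u in lborel. norm (?f i u) \<le> exp (- u\<^sup>2)" for i
      by (rule AE_I2) (simp add: indicator_def)
    show "integrable lborel (\<lambda>u::real. exp (- u\<^sup>2))" by (rule integral_gaussian)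
  qed measurable
  then show ?thesis
    by (simp add: smooth_step_def integral_gaussian)
qed

section \<open>Gaussian convolutions expressed through the characteristic function\<close>

context block_prob
begin

text \<open>The counterpart of \<open>nn_integral_mean_dist\<close> with a Gaussian in place of the
  weight and with \<open>x\<close> held fixed. Its right side involves the law only through its
  transform, and only under an integral over \<open>t\<close>.\<close>

lemma nn_integral_one_minus_gaussian_diff:
  assumes r: "r > 0"
  shows "ennreal ((sqrt pi / r) ^ (\<Sum>j<d. p j)) *
      (\<integral>\<^sup>+y. ennreal (1 - exp (- (block_inner d p (\<lambda>j k. x j k - y j k) (\<lambda>j k. x j k - y j k) / (4 * r\<^sup>2)))) \<partial>\<mu>)
    = (\<integral>\<^sup>+t. ennreal (exp (- (r\<^sup>2 * block_inner d p t t)) *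
        (1 - (cos (block_inner d p t x) * Re (Fourier d p \<mu> t)
        + sin (block_inner d p t x) * Im (Fourier d p \<mu> t)))) \<partial>block_space d p)"
proof -
  let ?D = "\<lambda>y j k. x j k - y j k"
  let ?C = "(sqrt pi / r) ^ (\<Sum>j<d. p j)"
  let ?e = "\<lambda>t. exp (- (r\<^sup>2 * block_inner d p t t))"
  let ?h = "\<lambda>t y. ennreal (?e t * (1 - cos (block_inner d p t (?D y))))"
  interpret Q: pair_sigma_finite "block_space d p" \<mu>
    unfolding pair_sigma_finite_def
    by (simp add: sigma_finite_block_space sigma_finite_measure_axioms)
  note [measurable] = borel_measurable_block_inner_self[OF measurable_fst]
  have [measurable]: "(\<lambda>z. block_inner d p (fst z) (?D (snd z)))
      \<in> borel_measurable (block_space d p \<Otimes>\<^sub>M \<mu>)"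
  proof (rule borel_measurable_block_inner)
    fix j k assume jk: "j < d" "k < p j"
    show "(\<lambda>z. fst z j k) \<in> borel_measurable (block_space d p \<Otimes>\<^sub>M \<mu>)"
      by (rule measurable_coordinate[where d = d and p = p, OF _ jk]) measurable
    have "(\<lambda>z. snd z j k) \<in> borel_measurable (block_space d p \<Otimes>\<^sub>M \<mu>)"
      by (rule measurable_coordinate[where d = d and p = p, OF _ jk]) measurable
    then show "(\<lambda>z. x j k - snd z j k) \<in> borel_measurable (block_space d p \<Otimes>\<^sub>M \<mu>)"
      by measurable
  qed
  have h_meas: "case_prod ?h \<in> borel_measurable (block_space d p \<Otimes>\<^sub>M \<mu>)"
    unfolding case_prod_beta by measurable
  have dd: "(\<lambda>y. block_inner d p (?D y) (?D y)) \<in> borel_measurable \<mu>"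
    by (rule borel_measurable_block_inner)
       (auto intro!: borel_measurable_diff measurable_coordinate[OF measurable_id_block_space])
  have td: "(\<lambda>y. block_inner d p t (?D y)) \<in> borel_measurable \<mu>" for t
    by (rule borel_measurable_block_inner)
       (auto intro!: borel_measurable_diff measurable_coordinate[OF measurable_id_block_space])
  note [measurable] = dd td
  have "ennreal ?C * (\<integral>\<^sup>+y. ennreal (1 - exp (- (block_inner d p (?D y) (?D y) / (4 * r\<^sup>2)))) \<partial>\<mu>)
      = (\<integral>\<^sup>+y. ennreal ?C * ennreal (1 - exp (- (block_inner d p (?D y) (?D y) / (4 * r\<^sup>2)))) \<partial>\<mu>)"
    by (rule nn_integral_cmult[symmetric]) measurable
  also have "\<dots> = (\<integral>\<^sup>+y. ennreal (?C * (1 - exp (- (block_inner d p (?D y) (?D y) / (4 * r\<^sup>2))))) \<partial>\<mu>)"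
    using r by (simp add: ennreal_mult')
  also have "\<dots> = (\<integral>\<^sup>+y. \<integral>\<^sup>+t. ?h t y \<partial>block_space d p \<partial>\<mu>)"
    unfolding nn_integral_block_gaussian_one_minus_cos[OF r] ..
  also have "\<dots> = (\<integral>\<^sup>+t. \<integral>\<^sup>+y. ?h t y \<partial>\<mu> \<partial>block_space d p)"
    by (rule Q.Fubini') (rule h_meas)
  also have "\<dots> = (\<integral>\<^sup>+t. ennreal (?e t * (1 - (cos (block_inner d p t x) * Re (Fourier d p \<mu> t)
        + sin (block_inner d p t x) * Im (Fourier d p \<mu> t)))) \<partial>block_space d p)"
  proof (rule nn_integral_cong)
    fix t
    have "(\<integral>\<^sup>+y. ?h t y \<partial>\<mu>)
        = (\<integral>\<^sup>+y. ennreal (?e t) * ennreal (1 - cos (block_inner d p t (?D y))) \<partial>\<mu>)"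
      by (simp add: ennreal_mult')
    also have "\<dots> = ennreal (?e t) * (\<integral>\<^sup>+y. ennreal (1 - cos (block_inner d p t (?D y))) \<partial>\<mu>)"
      by (rule nn_integral_cmult) measurable
    finally show "(\<integral>\<^sup>+y. ?h t y \<partial>\<mu>) = ennreal (?e t * (1 - (cos (block_inner d p t x) * Re (Fourier d p \<mu> t)
        + sin (block_inner d p t x) * Im (Fourier d p \<mu> t))))"
      unfolding nn_integral_one_minus_cos_diff by (simp add: ennreal_mult')
  qed
  finally show ?thesis .
qed

text \<open>The Gaussian is at most \<open>1\<close> and the law has mass \<open>1\<close>, so the
  two integrals add up to \<open>1\<close> and the truncated subtraction is exact.\<close>

lemma nn_integral_gaussian_diff:
  "(\<integral>\<^sup>+y. ennreal (exp (- (block_inner d p (\<lambda>j k. x j k - y j k) (\<lambda>j k. x j k - y j k) / (4 * r\<^sup>2)))) \<partial>\<mu>)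
    = 1 - (\<integral>\<^sup>+y. ennreal (1 - exp (- (block_inner d p (\<lambda>j k. x j k - y j k) (\<lambda>j k. x j k - y j k) / (4 * r\<^sup>2)))) \<partial>\<mu>)"
proof -
  let ?D = "\<lambda>y j k. x j k - y j k"
  let ?g = "\<lambda>y. exp (- (block_inner d p (?D y) (?D y) / (4 * r\<^sup>2)))"
  have [measurable]: "(\<lambda>y. block_inner d p (?D y) (?D y)) \<in> borel_measurable \<mu>"
    by (rule borel_measurable_block_inner)
       (auto intro!: borel_measurable_diff measurable_coordinate[OF measurable_id_block_space])
  have g1: "?g y \<le> 1" for y
    using block_inner_self_nonneg[of d p "?D y"] by simp
  have "(\<integral>\<^sup>+y. ennreal (?g y) \<partial>\<mu>) + (\<integral>\<^sup>+y. ennreal (1 - ?g y) \<partial>\<mu>)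
      = (\<integral>\<^sup>+y. ennreal (?g y) + ennreal (1 - ?g y) \<partial>\<mu>)"
    by (rule nn_integral_add[symmetric]) measurable
  also have "\<dots> = (\<integral>\<^sup>+y. 1 \<partial>\<mu>)"
    by (intro nn_integral_cong) (use g1 in \<open>simp flip: ennreal_plus\<close>)
  also have "\<dots> = 1" by (simp add: emeasure_space_1)
  finally have sum: "(\<integral>\<^sup>+y. ennreal (?g y) \<partial>\<mu>) + (\<integral>\<^sup>+y. ennreal (1 - ?g y) \<partial>\<mu>) = 1" .
  then have "(\<integral>\<^sup>+y. ennreal (1 - ?g y) \<partial>\<mu>) \<noteq> \<infinity>"
    by (metis ennreal_add_eq_top ennreal_one_neq_top infinity_ennreal_def)
  then show ?thesis
    unfolding sum[symmetric] by simp
qed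

text \<open>The unnormalised density of the Gaussian convolution is integrated over the lower box
  with corner \<open>b\<close>. After Tonelli the integral over \<open>x\<close> splits into
  coordinates, each contributing a smooth step and the Jacobian \<open>2 * r\<close>.\<close>

lemma nn_integral_smooth_step_prod:
  assumes r: "r > 0"
  shows "ennreal ((2 * r) ^ (\<Sum>j<d. p j)) *
      (\<integral>\<^sup>+y. ennreal (\<Prod>j<d. \<Prod>k<p j. smooth_step r (b j k) (y j k)) \<partial>\<mu>)
    = (\<integral>\<^sup>+x. (\<Prod>j<d. \<Prod>k<p j. indicator {..b j k} (x j k)) *
        (\<integral>\<^sup>+y. ennreal (exp (- (block_inner d p (\<lambda>j k. x j k - y j k) (\<lambda>j k. x j k - y j k) / (4 * r\<^sup>2)))) \<partial>\<mu>)
        \<partial>block_space d p)"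
proof -
  let ?E = "\<lambda>x y. ennreal (exp (- (block_inner d p (\<lambda>j k. x j k - y j k) (\<lambda>j k. x j k - y j k) / (4 * r\<^sup>2))))"
  let ?I = "\<lambda>x. (\<Prod>j<d. \<Prod>k<p j. indicator {..b j k} (x j k)) :: ennreal"
  let ?C = "(2 * r) ^ (\<Sum>j<d. p j)"
  let ?f = "\<lambda>y j k x. ennreal (indicator {..b j k} x * exp (- ((x - y j k)\<^sup>2 / (4 * r\<^sup>2))))"
  interpret Q: pair_sigma_finite "block_space d p" \<mu>
    unfolding pair_sigma_finite_def
    by (simp add: sigma_finite_block_space sigma_finite_measure_axioms)
  have coords: "(\<lambda>z. fst z j k) \<in> borel_measurable (block_space d p \<Otimes>\<^sub>M \<mu>)"
      "(\<lambda>z. snd z j k) \<in> borel_measurable (block_space d p \<Otimes>\<^sub>M \<mu>)"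
      "(\<lambda>x. x j k) \<in> borel_measurable (block_space d p)"
      "(\<lambda>x. x j k) \<in> borel_measurable \<mu>"
      if "j < d" "k < p j" for j k
    by (rule measurable_coordinate[where d = d and p = p, OF _ that], measurable)+
  have [measurable]: "(\<lambda>z. block_inner d p (\<lambda>j k. fst z j k - snd z j k) (\<lambda>j k. fst z j k - snd z j k))
      \<in> borel_measurable (block_space d p \<Otimes>\<^sub>M \<mu>)"
    by (rule borel_measurable_block_inner) (auto intro!: borel_measurable_diff coords)
  have [measurable]: "(\<lambda>y. block_inner d p (\<lambda>j k. x j k - y j k) (\<lambda>j k. x j k - y j k))
      \<in> borel_measurable \<mu>" for x
    by (rule borel_measurable_block_inner) (auto intro!: borel_measurable_diff coords)
  have [measurable]: "?I \<in> borel_measurable (block_space d p)"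
    by (intro borel_measurable_prod_ennreal measurable_compose[OF coords(3)]) auto
  have h_meas: "(\<lambda>(x, y). ?I x * ?E x y) \<in> borel_measurable (block_space d p \<Otimes>\<^sub>M \<mu>)"
    unfolding case_prod_beta by measurable
  have pm: "(\<lambda>y. ennreal (\<Prod>j<d. \<Prod>k<p j. smooth_step r (b j k) (y j k))) \<in> borel_measurable \<mu>"
    by (intro measurable_compose[OF _ measurable_ennreal] borel_measurable_prod
        measurable_compose[OF coords(4) measurable_smooth_step]) auto
  have prod: "?I x * ?E x y = (\<Prod>j<d. \<Prod>k<p j. ?f y j k (x j k))" for x y
  proof -
    have "?E x y = ennreal (\<Prod>j<d. \<Prod>k<p j. exp (- ((x j k - y j k)\<^sup>2 / (4 * r\<^sup>2))))"
      by (simp add: exp_sum[symmetric] block_inner_def euclid_inner_def sum_negf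
          sum_divide_distrib power2_eq_square)
    also have "\<dots> = (\<Prod>j<d. \<Prod>k<p j. ennreal (exp (- ((x j k - y j k)\<^sup>2 / (4 * r\<^sup>2)))))"
      by (simp add: prod_ennreal[symmetric] prod_nonneg)
    finally show ?thesis
      by (simp add: prod.distrib[symmetric] ennreal_mult' ennreal_indicator)
  qed
  have inner: "(\<integral>\<^sup>+x. ?I x * ?E x y \<partial>block_space d p)
      = ennreal ?C * ennreal (\<Prod>j<d. \<Prod>k<p j. smooth_step r (b j k) (y j k))" for y
  proof -
    have "(\<integral>\<^sup>+x. ?I x * ?E x y \<partial>block_space d p)
        = (\<Prod>j<d. \<Prod>k<p j. \<integral>\<^sup>+x. ?f y j k x \<partial>lborel)"
      unfolding prod by (rule nn_integral_block_space_prod) measurable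
    also have "\<dots> = ennreal (\<Prod>j<d. \<Prod>k<p j. 2 * r * smooth_step r (b j k) (y j k))"
      unfolding nn_integral_gaussian_below[OF r]
      using r by (simp add: prod_ennreal prod_nonneg smooth_step_bounds)
    also have "(\<Prod>j<d. \<Prod>k<p j. 2 * r * smooth_step r (b j k) (y j k))
        = ?C * (\<Prod>j<d. \<Prod>k<p j. smooth_step r (b j k) (y j k))"
      by (simp add: prod.distrib power_sum power_mult_distrib)
    finally show ?thesis
      using r by (simp add: ennreal_mult')
  qed
  have "(\<integral>\<^sup>+x. ?I x * (\<integral>\<^sup>+y. ?E x y \<partial>\<mu>) \<partial>block_space d p)
      = (\<integral>\<^sup>+x. \<integral>\<^sup>+y. ?I x * ?E x y \<partial>\<mu> \<partial>block_space d p)"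
    by (intro nn_integral_cong nn_integral_cmult[symmetric]) measurable
  also have "\<dots> = (\<integral>\<^sup>+y. \<integral>\<^sup>+x. ?I x * ?E x y \<partial>block_space d p \<partial>\<mu>)"
    by (rule Q.Fubini'[symmetric]) (rule h_meas)
  also have "\<dots> = ennreal ?C * (\<integral>\<^sup>+y. ennreal (\<Prod>j<d. \<Prod>k<p j. smooth_step r (b j k) (y j k)) \<partial>\<mu>)"
    unfolding inner by (rule nn_integral_cmult) (rule pm)
  finally show ?thesis ..
qed

text \<open>Each factor is at most \<open>sqrt pi\<close>, so a constant dominates, and it is
  integrable because the law has finite mass.\<close>

lemma tendsto_nn_integral_smooth_step:
  "(\<lambda>i. \<integral>\<^sup>+y. ennreal (\<Prod>j<d. \<Prod>k<p j. smooth_step ((inverse (real (Suc i)))\<^sup>2)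
      (a j k + inverse (real (Suc i))) (y j k)) \<partial>\<mu>)
    \<longlonglongrightarrow> ennreal (sqrt pi ^ (\<Sum>j<d. p j)) * emeasure \<mu> (lower_box d p a)"
proof -
  let ?S = "\<lambda>i j k y. smooth_step ((inverse (real (Suc i)))\<^sup>2) (a j k + inverse (real (Suc i))) y"
  let ?c = "sqrt pi ^ (\<Sum>j<d. p j)"
  have coord: "(\<lambda>x. x j k) \<in> borel_measurable \<mu>" if "j < d" "k < p j" for j k
    by (rule measurable_coordinate[where d = d and p = p, OF _ that]) measurable
  have [measurable]: "lower_box d p a \<in> sets \<mu>"
    by (simp add: sets_eq lower_box_in_sets)
  have c: "(\<Prod>j<d. \<Prod>k<p j. sqrt pi) = ?c"
    by (simp add: power_sum)
  have lim: "(\<Prod>j<d. \<Prod>k<p j. indicator {..a j k} (y j k) * sqrt pi) = ?c * indicator (lower_box d p a) y"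
    if y: "y \<in> space \<mu>" for y
  proof -
    have "(\<Prod>j<d. \<Prod>k<p j. indicator {..a j k} (y j k)) = (indicator (lower_box d p a) y :: real)"
    proof (cases "y \<in> lower_box d p a")
      case True
      then show ?thesis by (simp add: lower_box_def)
    next
      case False
      then obtain j k where jk: "j < d" "k < p j" "\<not> y j k \<le> a j k"
        using y sets_eq_imp_space_eq[OF sets_eq] by (auto simp: lower_box_def)
      have "(\<Prod>k<p j. indicator {..a j k} (y j k)) = (0::real)"
        by (rule prod_zero[OF _ bexI[of _ k]]) (use jk in auto)
      with jk(1) have "\<exists>j\<in>{..<d}. (\<Prod>k<p j. indicator {..a j k} (y j k)) = (0::real)"
        by blast
      then have "(\<Prod>j<d. \<Prod>k<p j. indicator {..a j k} (y j k)) = (0::real)"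
        by (rule prod_zero[OF finite_lessThan])
      then show ?thesis using False by simp
    qed
    then show ?thesis by (simp only: prod.distrib c mult.commute)
  qed
  have "(\<lambda>i. \<integral>\<^sup>+y. ennreal (\<Prod>j<d. \<Prod>k<p j. ?S i j k (y j k)) \<partial>\<mu>)
      \<longlonglongrightarrow> (\<integral>\<^sup>+y. ennreal ?c * indicator (lower_box d p a) y \<partial>\<mu>)"
  proof (rule nn_integral_dominated_convergence[where w = "\<lambda>_. ennreal ?c"])
    show "(\<lambda>y. ennreal (\<Prod>j<d. \<Prod>k<p j. ?S i j k (y j k))) \<in> borel_measurable \<mu>" for i
      by (intro measurable_compose[OF _ measurable_ennreal] borel_measurable_prod
          measurable_compose[OF coord measurable_smooth_step]) auto
    show "AE y in \<mu>. ennreal (\<Prod>j<d. \<Prod>k<p j. ?S i j k (y j k)) \<le> ennreal ?c" for i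
      unfolding c[symmetric]
      by (intro AE_I2 ennreal_leI prod_mono conjI prod_nonneg ballI smooth_step_bounds)
    show "AE y in \<mu>. (\<lambda>i. ennreal (\<Prod>j<d. \<Prod>k<p j. ?S i j k (y j k)))
        \<longlonglongrightarrow> ennreal ?c * indicator (lower_box d p a) y"
    proof (rule AE_I2)
      fix y assume y: "y \<in> space \<mu>"
      have "(\<lambda>i. ennreal (\<Prod>j<d. \<Prod>k<p j. ?S i j k (y j k)))
          \<longlonglongrightarrow> ennreal (\<Prod>j<d. \<Prod>k<p j. indicator {..a j k} (y j k) * sqrt pi)"
        by (intro tendsto_ennrealI tendsto_prod tendsto_smooth_step)
      then show "(\<lambda>i. ennreal (\<Prod>j<d. \<Prod>k<p j. ?S i j k (y j k)))
          \<longlonglongrightarrow> ennreal ?c * indicator (lower_box d p a) y"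
        unfolding lim[OF y] by (simp add: ennreal_mult' ennreal_indicator)
    qed
    show "(\<integral>\<^sup>+y. ennreal ?c \<partial>\<mu>) < \<infinity>"
      by (simp add: emeasure_space_1)
  qed measurable
  then show ?thesis
    by (simp add: nn_integral_cmult_indicator)
qed

end

context block_prob_pair
begin

text \<open>Equality almost everywhere suffices without appeal to continuity, because the transforms
  occur only inside integrals over \<open>t\<close>.\<close>

lemma eq_if_Fourier_AE_eq:
  assumes eq: "AE t in block_space d p. Fourier d p \<mu> t = Fourier d p \<nu> t"
  shows "\<mu> = \<nu>"
proof -
  let ?N = "\<lambda>x y. block_inner d p (\<lambda>j k. x j k - y j k) (\<lambda>j k. x j k - y j k)"
  have gauss: "(\<integral>\<^sup>+y. ennreal (exp (- (?N x y / (4 * r\<^sup>2)))) \<partial>\<mu>)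
      = (\<integral>\<^sup>+y. ennreal (exp (- (?N x y / (4 * r\<^sup>2)))) \<partial>\<nu>)" if r: "r > 0" for r x
  proof -
    have "ennreal ((sqrt pi / r) ^ (\<Sum>j<d. p j)) * (\<integral>\<^sup>+y. ennreal (1 - exp (- (?N x y / (4 * r\<^sup>2)))) \<partial>\<mu>)
        = ennreal ((sqrt pi / r) ^ (\<Sum>j<d. p j)) * (\<integral>\<^sup>+y. ennreal (1 - exp (- (?N x y / (4 * r\<^sup>2)))) \<partial>\<nu>)"
      unfolding \<mu>.nn_integral_one_minus_gaussian_diff[OF r] \<nu>.nn_integral_one_minus_gaussian_diff[OF r]
      by (rule nn_integral_cong_AE) (use eq in eventually_elim, simp)
    then show ?thesis
      unfolding \<mu>.nn_integral_gaussian_diff \<nu>.nn_integral_gaussian_diff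
      using r by (simp add: ennreal_mult_cancel_left)
  qed
  have smooth: "(\<integral>\<^sup>+y. ennreal (\<Prod>j<d. \<Prod>k<p j. smooth_step r (b j k) (y j k)) \<partial>\<mu>)
      = (\<integral>\<^sup>+y. ennreal (\<Prod>j<d. \<Prod>k<p j. smooth_step r (b j k) (y j k)) \<partial>\<nu>)"
    if r: "r > 0" for r b
  proof -
    have "ennreal ((2 * r) ^ (\<Sum>j<d. p j)) * (\<integral>\<^sup>+y. ennreal (\<Prod>j<d. \<Prod>k<p j. smooth_step r (b j k) (y j k)) \<partial>\<mu>)
        = ennreal ((2 * r) ^ (\<Sum>j<d. p j)) * (\<integral>\<^sup>+y. ennreal (\<Prod>j<d. \<Prod>k<p j. smooth_step r (b j k) (y j k)) \<partial>\<nu>)"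
      unfolding \<mu>.nn_integral_smooth_step_prod[OF r] \<nu>.nn_integral_smooth_step_prod[OF r] gauss[OF r] ..
    then show ?thesis
      using r by (simp add: ennreal_mult_cancel_left)
  qed
  have box: "emeasure \<mu> (lower_box d p a) = emeasure \<nu> (lower_box d p a)" for a
  proof -
    have "ennreal (sqrt pi ^ (\<Sum>j<d. p j)) * emeasure \<mu> (lower_box d p a)
        = ennreal (sqrt pi ^ (\<Sum>j<d. p j)) * emeasure \<nu> (lower_box d p a)"
      by (rule LIMSEQ_unique[OF \<mu>.tendsto_nn_integral_smooth_step])
         (subst smooth, simp, rule \<nu>.tendsto_nn_integral_smooth_step)
    then show ?thesis
      by (simp add: ennreal_mult_cancel_left)
  qed
  show ?thesis
  proof (rule measure_eqI_generator_eq[where E = "range (lower_box d p)" and \<Omega> = "space (block_space d p)"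
        and A = "\<lambda>n. lower_box d p (\<lambda>j k. real n)"])
    show "Int_stable (range (lower_box d p))" by (rule Int_stable_range_lower_box)
    show "range (lower_box d p) \<subseteq> Pow (space (block_space d p))" by (auto simp: lower_box_def)
    show "emeasure \<mu> X = emeasure \<nu> X" if "X \<in> range (lower_box d p)" for X
      using that box by auto
    show "sets \<mu> = sigma_sets (space (block_space d p)) (range (lower_box d p))"
      "sets \<nu> = sigma_sets (space (block_space d p)) (range (lower_box d p))"
      by (simp_all only: \<mu>.sets_eq \<nu>.sets_eq sets_block_space_eq_lower_box[symmetric])
    show "(\<Union>n. lower_box d p (\<lambda>j k. real n)) = space (block_space d p)" by (rule UN_lower_box)
    show "range (\<lambda>n. lower_box d p (\<lambda>j k. real n)) \<subseteq> range (lower_box d p)" by blast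
    show "emeasure \<mu> (lower_box d p (\<lambda>j k. real n)) \<noteq> \<infinity>" for n
      using \<mu>.emeasure_finite by simp
  qed
qed

end

section \<open>The complete measure of mutual dependence\<close>

lemma block_dist_le_sum:
  "block_dist d p x y \<le> (\<Sum>j<d. \<Sum>k<p j. \<bar>x j k\<bar> + \<bar>y j k\<bar>)"
proof -
  let ?z = "\<lambda>(j, k). x j k - y j k"
  have "block_dist d p x y = L2_set ?z (Sigma {..<d} (\<lambda>j. {..<p j}))"
    unfolding block_dist_def block_norm_def block_inner_def euclid_inner_def L2_set_def
    by (simp add: sum.Sigma power2_eq_square split_def)
  also have "\<dots> \<le> (\<Sum>i\<in>Sigma {..<d} (\<lambda>j. {..<p j}). \<bar>?z i\<bar>)"
    by (rule L2_set_le_sum_abs)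
  also have "\<dots> = (\<Sum>j<d. \<Sum>k<p j. \<bar>x j k - y j k\<bar>)"
    by (simp add: sum.Sigma split_def)
  also have "\<dots> \<le> (\<Sum>j<d. \<Sum>k<p j. \<bar>x j k\<bar> + \<bar>y j k\<bar>)"
    by (intro sum_mono abs_triangle_ineq4)
  finally show ?thesis .
qed

text \<open>Moments are required coordinate by coordinate because this is how they pass from the law
  of \<open>X\<close> to the product of its marginals: each coordinate lies in a single
  block.\<close>

lemma (in block_prob_pair) mean_dist_finite:
  assumes \<mu>: "\<And>j k. j < d \<Longrightarrow> k < p j \<Longrightarrow> integrable \<mu> (\<lambda>x. x j k)"
    and \<nu>: "\<And>j k. j < d \<Longrightarrow> k < p j \<Longrightarrow> integrable \<nu> (\<lambda>x. x j k)"
  shows "mean_dist d p \<mu> \<nu> < \<infinity>"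
proof -
  let ?s = "\<lambda>x. \<Sum>j<d. \<Sum>k<p j. \<bar>x j k\<bar>"
  have int: "integrable \<mu> ?s" "integrable \<nu> ?s"
    by (auto intro!: Bochner_Integration.integrable_sum integrable_abs \<mu> \<nu>)
  note [measurable] = int[THEN borel_measurable_integrable]
  have s: "0 \<le> ?s x" for x :: "nat \<Rightarrow> nat \<Rightarrow> real"
    by (intro sum_nonneg) auto
  have fin: "(\<integral>\<^sup>+x. ennreal (?s x) \<partial>\<mu>) < \<infinity>" "(\<integral>\<^sup>+x. ennreal (?s x) \<partial>\<nu>) < \<infinity>"
    using nn_integral_eq_integral[OF int(1)] nn_integral_eq_integral[OF int(2)] s by auto
  have "mean_dist d p \<mu> \<nu> \<le> (\<integral>\<^sup>+x. \<integral>\<^sup>+y. ennreal (?s x) + ennreal (?s y) \<partial>\<nu> \<partial>\<mu>)"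
    unfolding mean_dist_def
    by (intro nn_integral_mono)
       (use block_dist_le_sum s in \<open>simp add: sum.distrib ennreal_leI flip: ennreal_plus\<close>)
  also have "\<dots> = (\<integral>\<^sup>+x. ennreal (?s x) + (\<integral>\<^sup>+y. ennreal (?s y) \<partial>\<nu>) \<partial>\<mu>)"
    by (subst nn_integral_add) (simp_all add: \<nu>.emeasure_space_1)
  also have "\<dots> = (\<integral>\<^sup>+x. ennreal (?s x) \<partial>\<mu>) + (\<integral>\<^sup>+y. ennreal (?s y) \<partial>\<nu>)"
    by (subst nn_integral_add) (simp_all add: \<mu>.emeasure_space_1)
  also have "\<dots> < \<infinity>" using fin by simp
  finally show ?thesis .
qed

text \<open>Independence makes the joint law a product, and the expectation an iterated integral. If
  the mean distance is infinite, both sides take the default value \<open>0\<close>.\<close>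

lemma (in prob_space) integral_block_dist_indep:
  assumes ind: "indep_var (block_space d p) X (block_space d p) Y"
  shows "(LINT \<omega>|M. block_dist d p (X \<omega>) (Y \<omega>))
    = enn2real (mean_dist d p (distr M (block_space d p) X) (distr M (block_space d p) Y))"
proof -
  let ?B = "block_space d p"
  have XY [measurable]: "X \<in> measurable M ?B" "Y \<in> measurable M ?B"
    and prod: "distr M ?B X \<Otimes>\<^sub>M distr M ?B Y = distr M (?B \<Otimes>\<^sub>M ?B) (\<lambda>\<omega>. (X \<omega>, Y \<omega>))"
    using ind unfolding indep_var_distribution_eq by auto
  interpret Y: prob_space "distr M ?B Y" by (rule prob_space_distr) measurable
  have [measurable]: "(\<lambda>z. block_dist d p (fst z) (snd z)) \<in> borel_measurable (?B \<Otimes>\<^sub>M ?B)"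
    by (rule borel_measurable_block_dist) measurable
  have "mean_dist d p (distr M ?B X) (distr M ?B Y)
      = (\<integral>\<^sup>+z. ennreal (block_dist d p (fst z) (snd z)) \<partial>(distr M ?B X \<Otimes>\<^sub>M distr M ?B Y))"
    unfolding mean_dist_def by (subst Y.nn_integral_fst[symmetric]) auto
  also have "\<dots> = (\<integral>\<^sup>+\<omega>. ennreal (block_dist d p (X \<omega>) (Y \<omega>)) \<partial>M)"
    unfolding prod by (subst nn_integral_distr) auto
  finally show ?thesis
    using borel_measurable_block_dist[OF XY]
    by (subst integral_eq_nn_integral) (auto simp: block_dist_def block_norm_nonneg)
qed

text \<open>The subfamilies over the disjoint sets \<open>{i}\<close> and \<open>{j}\<close> are
  independent; evaluating them at their only index recovers \<open>Y i\<close> and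
  \<open>Y j\<close>.\<close>

lemma (in prob_space) indep_vars_imp_indep_var:
  assumes "indep_vars (\<lambda>_. N) Y I" "i \<in> I" "j \<in> I" "i \<noteq> j"
  shows "indep_var N (Y i) N (Y j)"
proof -
  have "indep_var N ((\<lambda>f. f i) \<circ> (\<lambda>\<omega>. restrict (\<lambda>l. Y l \<omega>) {i}))
      N ((\<lambda>f. f j) \<circ> (\<lambda>\<omega>. restrict (\<lambda>l. Y l \<omega>) {j}))"
    by (rule indep_var_compose[OF indep_var_restrict[OF assms(1)]]) (use assms in auto)
  then show ?thesis by (simp add: comp_def)
qed

theorem theorem1:
  fixes M :: "'a measure"
    and d :: nat
    and p :: "nat \<Rightarrow> nat"
    and X :: "'a \<Rightarrow> nat \<Rightarrow> nat \<Rightarrow> real"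
  assumes "prob_space M"
    and "d \<ge> 2"
    and "\<And>j. j < d \<Longrightarrow> p j \<ge> 1"
    and "X \<in> measurable M (block_space d p)"
    and "\<And>j. j < d \<Longrightarrow>
           absolutely_continuous (euclid (p j)) (distr M (euclid (p j)) (\<lambda>\<omega>. X \<omega> j))"
    and "integrable M (\<lambda>\<omega>. block_norm d p (X \<omega>))"
  shows "complete_dependence M d p X < \<infinity>
    \<and> (complete_dependence M d p X = 0 \<longleftrightarrow>
         prob_space.indep_vars M (\<lambda>j. euclid (p j)) (\<lambda>j \<omega>. X \<omega> j) {..<d})
    \<and> (\<forall>X' Xt Xt'.
         distr M (block_space d p) X' = distr M (block_space d p) X
         \<and> (\<forall>j<d. distr M (euclid (p j)) (\<lambda>\<omega>. Xt \<omega> j) = distr M (euclid (p j)) (\<lambda>\<omega>. X \<omega> j))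
         \<and> prob_space.indep_vars M (\<lambda>j. euclid (p j)) (\<lambda>j \<omega>. Xt \<omega> j) {..<d}
         \<and> distr M (block_space d p) Xt' = distr M (block_space d p) Xt
         \<and> prob_space.indep_vars M (\<lambda>i. block_space d p) (\<lambda>i. [X, X', Xt, Xt'] ! i) {..<4::nat}
         \<longrightarrow> enn2real (complete_dependence M d p X) =
               (LINT \<omega>|M. block_dist d p (X \<omega>) (Xt' \<omega>))
             + (LINT \<omega>|M. block_dist d p (X' \<omega>) (Xt \<omega>))
             - (LINT \<omega>|M. block_dist d p (X \<omega>) (X' \<omega>))
             - (LINT \<omega>|M. block_dist d p (Xt \<omega>) (Xt' \<omega>)))"
proof -
  interpret prob_space M by fact
  let ?B = "block_space d p"
  note X [measurable] = assms(4)
  define \<mu> where "\<mu> = distr M ?B X"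
  define marg where "marg j = distr M (euclid (p j)) (\<lambda>\<omega>. X \<omega> j)" for j
  \<comment> \<open>The law that an independent-component copy must have, built directly from the
    marginals: finiteness and the zero criterion are then proved without any copies living on
    \<open>M\<close>.\<close>
  define \<nu> where "\<nu> = PiM {..<d} marg"
  have comp: "(\<lambda>\<omega>. Y \<omega> j) \<in> measurable M (euclid (p j))"
    if "Y \<in> measurable M ?B" "j < d" for Y j
    using measurable_compose[OF that(1) measurable_block_component[OF that(2)]] .
  have marg: "prob_space (marg j)" if "j < d" for j
    unfolding marg_def by (rule prob_space_distr) (rule comp[OF X that])
  have sets_\<nu>: "sets \<nu> = sets ?B"
    unfolding \<nu>_def block_space_def by (rule sets_PiM_cong) (auto simp: marg_def)
  \<comment> \<open>The library criterion speaks of the restricted tuple. Points of the block space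
    are extensional, so restriction changes nothing; the index set is nonempty by
    \<open>d \<ge> 2\<close>.\<close>
  have indep_iff: "indep_vars (\<lambda>j. euclid (p j)) (\<lambda>j \<omega>. Y \<omega> j) {..<d} \<longleftrightarrow>
      distr M ?B Y = PiM {..<d} (\<lambda>j. distr M (euclid (p j)) (\<lambda>\<omega>. Y \<omega> j))"
    if Y: "Y \<in> measurable M ?B" for Y
  proof -
    have "distr M (PiM {..<d} (\<lambda>j. euclid (p j))) (\<lambda>\<omega>. \<lambda>j\<in>{..<d}. Y \<omega> j) = distr M ?B Y"
    proof (rule distr_cong)
      fix \<omega> assume "\<omega> \<in> space M"
      then have "Y \<omega> \<in> space ?B" by (rule measurable_space[OF Y])
      then show "(\<lambda>j\<in>{..<d}. Y \<omega> j) = Y \<omega>"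
        unfolding block_space_def space_PiM by (rule PiE_restrict)
    qed (simp_all add: block_space_def)
    moreover have "{..<d} \<noteq> {}"
      using assms(2) by (simp add: lessThan_empty_iff)
    ultimately show ?thesis
      by (subst indep_vars_iff_distr_eq_PiM') (auto intro: comp[OF Y])
  qed
  interpret block_prob_pair \<mu> \<nu> d p
  proof (intro block_prob_pair.intro block_prob.intro block_prob_axioms.intro)
    show "prob_space \<mu>" unfolding \<mu>_def by (rule prob_space_distr) (rule X)
    show "prob_space \<nu>" unfolding \<nu>_def by (rule prob_space_PiM) (use marg in auto)
  qed (simp_all add: \<mu>_def sets_\<nu>)
  interpret \<mu>\<mu>: block_prob_pair \<mu> \<mu> d p by (rule \<mu>.block_prob_pair_self)
  interpret \<nu>\<nu>: block_prob_pair \<nu> \<nu> d p by (rule \<nu>.block_prob_pair_self)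
  have joint: "joint_char M d p X t = Fourier d p \<mu> t" for t
    unfolding joint_char_def Fourier_def \<mu>_def by (subst integral_distr) auto
  have product: "product_char M d p X t = Fourier d p \<nu> t" for t
  proof -
    have meas: "(\<lambda>x. iexp (euclid_inner (p j) (t j) x)) \<in> borel_measurable (euclid (p j))" for j
    proof -
      have [measurable]: "(\<lambda>x. euclid_inner (p j) (t j) x) \<in> borel_measurable (euclid (p j))"
        unfolding euclid_inner_def
        by (intro borel_measurable_sum borel_measurable_times measurable_euclid_component) auto
      show ?thesis by measurable
    qed
    \<comment> \<open>The product locale wants a probability measure at every index, but nothing is
      known of \<open>marg j\<close> for \<open>j \<ge> d\<close>; a point mass at the zero vector
      fills these indices.\<close>
    define N where "N j = (if j < d then marg j else return (euclid (p j)) (\<lambda>k\<in>{..<p j}. 0))" for j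
    have "(\<lambda>k\<in>{..<p j}. 0) \<in> space (euclid (p j))" for j
      by (simp add: euclid_def space_PiM)
    then have "prob_space (N j)" for j
      unfolding N_def using marg[of j] by (auto intro: prob_space_return)
    then interpret N: product_prob_space N
      by (intro product_prob_spaceI)
    have \<nu>: "\<nu> = PiM {..<d} N"
      unfolding \<nu>_def by (rule PiM_cong) (auto simp: N_def)
    have int: "integrable (N j) (\<lambda>x. iexp (euclid_inner (p j) (t j) x))" if "j < d" for j
      by (rule finite_measure.integrable_const_bound[where B = 1])
         (use that meas[of j] \<open>prob_space (N j)\<close> in
           \<open>auto simp: N_def marg_def prob_space.finite_measure cong: measurable_cong_sets\<close>)
    have "Fourier d p \<nu> t = (LINT x|PiM {..<d} N. (\<Prod>j<d. iexp (euclid_inner (p j) (t j) (x j))))"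
      unfolding Fourier_def \<nu> block_inner_def
      by (simp add: exp_sum[symmetric] sum_distrib_left)
    also have "\<dots> = (\<Prod>j<d. LINT x|N j. iexp (euclid_inner (p j) (t j) x))"
      by (rule N.product_integral_prod) (use int in auto)
    also have "\<dots> = product_char M d p X t"
      unfolding product_char_def
      by (intro prod.cong refl)
         (simp add: N_def marg_def integral_distr[OF comp[OF X] meas])
    finally show ?thesis ..
  qed
  have coord_\<mu>: "integrable \<mu> (\<lambda>x. x j k)" if "j < d" "k < p j" for j k
  proof -
    have m: "(\<lambda>x. x j k) \<in> borel_measurable ?B"
      by (rule measurable_coordinate[where d = d and p = p, OF _ that]) measurable
    have "integrable M (\<lambda>\<omega>. X \<omega> j k)"
      by (rule Bochner_Integration.integrable_bound[OF assms(6)])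
         (use measurable_compose[OF X m] abs_coordinate_le_norm[where d = d and p = p, OF that] in
           \<open>auto simp: abs_of_nonneg[OF block_norm_nonneg]\<close>)
    then show ?thesis
      unfolding \<mu>_def using m by (simp add: integrable_distr_eq)
  qed
  have coord_\<nu>: "integrable \<nu> (\<lambda>x. x j k)" if "j < d" "k < p j" for j k
  proof -
    have m: "(\<lambda>x. x k) \<in> borel_measurable (euclid (p j))"
      by (rule measurable_euclid_component[OF that(2)])
    have pr: "(\<lambda>x. x j) \<in> measurable ?B (euclid (p j))"
      by (rule measurable_block_component[OF that(1)])
    have "integrable M (\<lambda>\<omega>. X \<omega> j k)"
      using coord_\<mu>[OF that] measurable_compose[OF pr m] unfolding \<mu>_def by (simp add: integrable_distr_eq)
    then have "integrable (marg j) (\<lambda>x. x k)"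
      unfolding marg_def using m comp[OF X that(1)] by (simp add: integrable_distr_eq)
    \<comment> \<open>Projecting the product law to block \<open>j\<close> gives back that marginal,
      so \<open>\<nu>\<close> inherits the coordinate moments of \<open>X\<close>.\<close>
    also have "marg j = distr \<nu> (marg j) (\<lambda>x. x j)"
      unfolding \<nu>_def by (rule distr_PiM_component[symmetric]) (use marg that in auto)
    finally have "integrable (distr \<nu> (marg j) (\<lambda>x. x j)) (\<lambda>x. x k)" .
    moreover have "(\<lambda>x. x j) \<in> measurable \<nu> (marg j)"
      unfolding \<nu>_def by (rule measurable_component_singleton) (use that in auto)
    moreover have "(\<lambda>x. x k) \<in> borel_measurable (marg j)"
      using m by (simp add: marg_def)
    ultimately show ?thesis
      by (subst (asm) integrable_distr_eq) auto
  qed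
  have fin: "mean_dist d p \<mu> \<nu> < \<infinity>" "mean_dist d p \<mu> \<mu> < \<infinity>" "mean_dist d p \<nu> \<nu> < \<infinity>"
    by (intro mean_dist_finite \<mu>\<mu>.mean_dist_finite \<nu>\<nu>.mean_dist_finite coord_\<mu> coord_\<nu>; assumption)+
  let ?Q = "complete_dependence M d p X"
  have Q: "?Q = (\<integral>\<^sup>+t. ennreal ((cmod (Fourier d p \<mu> t - Fourier d p \<nu> t))\<^sup>2 * weight d p t) \<partial>?B)"
    unfolding complete_dependence_def joint product ..
  have energy: "?Q + mean_dist d p \<mu> \<mu> + mean_dist d p \<nu> \<nu> = 2 * mean_dist d p \<mu> \<nu>"
    unfolding Q by (rule energy_identity)
  have Q_fin: "?Q < \<infinity>"
  proof -
    have "?Q \<le> 2 * mean_dist d p \<mu> \<nu>"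
      unfolding energy[symmetric] by (simp add: add.assoc)
    also have "\<dots> < \<infinity>" using fin(1) by (simp add: ennreal_mult_less_top)
    finally show ?thesis .
  qed
  have "?Q = 0 \<longleftrightarrow> \<mu> = \<nu>"
  proof
    assume "?Q = 0"
    then have "AE t in ?B. ennreal ((cmod (Fourier d p \<mu> t - Fourier d p \<nu> t))\<^sup>2 * weight d p t) = 0"
      unfolding Q by (subst (asm) nn_integral_0_iff_AE) auto
    then have "AE t in ?B. Fourier d p \<mu> t = Fourier d p \<nu> t"
    proof eventually_elim
      case (elim t)
      show ?case
      \<comment> \<open>Where the norm vanishes, the weight is \<open>0\<close> by convention and
        says nothing, but there both transforms equal \<open>1\<close>.\<close>
      proof (cases "block_norm d p t = 0")
        case True
        then show ?thesis
          by (simp add: Fourier_def block_inner_norm_0 \<mu>.prob_space \<nu>.prob_space)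
      next
        case False
        then have "weight d p t > 0"
          unfolding weight_def using K_const_pos[of "\<Sum>j<d. p j"] block_norm_nonneg[of d p t] by auto
        then show ?thesis
          using elim by (simp add: ennreal_eq_0_iff mult_le_0_iff not_le)
      qed
    qed
    then show "\<mu> = \<nu>" by (rule eq_if_Fourier_AE_eq)
  next
    assume "\<mu> = \<nu>"
    then show "?Q = 0" unfolding Q by simp
  qed
  also have "\<mu> = \<nu> \<longleftrightarrow> indep_vars (\<lambda>j. euclid (p j)) (\<lambda>j \<omega>. X \<omega> j) {..<d}"
    unfolding indep_iff[OF X] \<mu>_def \<nu>_def marg_def ..
  finally have zero_iff: "?Q = 0 \<longleftrightarrow> indep_vars (\<lambda>j. euclid (p j)) (\<lambda>j \<omega>. X \<omega> j) {..<d}" .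
  \<comment> \<open>Only here are mean distances subtracted, so their finiteness is used to pass
    from \<open>ennreal\<close> to the reals.\<close>
  have real: "enn2real ?Q = enn2real (mean_dist d p \<mu> \<nu>) + enn2real (mean_dist d p \<mu> \<nu>)
      - enn2real (mean_dist d p \<mu> \<mu>) - enn2real (mean_dist d p \<nu> \<nu>)"
  proof -
    have "enn2real (?Q + mean_dist d p \<mu> \<mu> + mean_dist d p \<nu> \<nu>)
        = enn2real (mean_dist d p \<mu> \<nu> + mean_dist d p \<mu> \<nu>)"
      unfolding energy by (simp add: mult_2)
    then show ?thesis
      using fin Q_fin by (simp add: enn2real_plus)
  qed
  have repr: "enn2real ?Q =
               (LINT \<omega>|M. block_dist d p (X \<omega>) (Xt' \<omega>))
             + (LINT \<omega>|M. block_dist d p (X' \<omega>) (Xt \<omega>))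
             - (LINT \<omega>|M. block_dist d p (X \<omega>) (X' \<omega>))
             - (LINT \<omega>|M. block_dist d p (Xt \<omega>) (Xt' \<omega>))"
    if X': "distr M ?B X' = distr M ?B X"
      and Xt_marg: "\<forall>j<d. distr M (euclid (p j)) (\<lambda>\<omega>. Xt \<omega> j) = distr M (euclid (p j)) (\<lambda>\<omega>. X \<omega> j)"
      and Xt_ind: "indep_vars (\<lambda>j. euclid (p j)) (\<lambda>j \<omega>. Xt \<omega> j) {..<d}"
      and Xt': "distr M ?B Xt' = distr M ?B Xt"
      and ind: "indep_vars (\<lambda>i. ?B) (\<lambda>i. [X, X', Xt, Xt'] ! i) {..<4::nat}"
    for X' Xt Xt'
  proof -
    \<comment> \<open>Each of the four expectations involves two of the four vectors, so pairwise
      independence reduces it to a mean distance between \<open>\<mu>\<close> and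
      \<open>\<nu>\<close>.\<close>
    have pair: "indep_var ?B ([X, X', Xt, Xt'] ! i) ?B ([X, X', Xt, Xt'] ! j)"
      if "i < 4" "j < 4" "i \<noteq> j" for i j
      by (rule indep_vars_imp_indep_var[OF ind]) (use that in auto)
    \<comment> \<open>Measurability is extracted from independence; it allows
      \<open>indep_iff\<close> to identify the law of \<open>Xt\<close> with
      \<open>\<nu>\<close>.\<close>
    have Xt: "Xt \<in> measurable M ?B"
      using pair[of 2 3] indep_var_rv1 by (simp add: numeral_2_eq_2) 
    have "distr M ?B Xt = PiM {..<d} (\<lambda>j. distr M (euclid (p j)) (\<lambda>\<omega>. Xt \<omega> j))"
      using indep_iff[OF Xt] Xt_ind by blast
    also have "\<dots> = \<nu>"
      unfolding \<nu>_def marg_def by (rule PiM_cong) (use Xt_marg in auto)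
    finally have \<nu>: "distr M ?B Xt = \<nu>" .
    have "(LINT \<omega>|M. block_dist d p (X \<omega>) (Xt' \<omega>)) = enn2real (mean_dist d p \<mu> \<nu>)"
      using integral_block_dist_indep[OF pair[of 0 3]] by (simp add: Xt' \<nu> \<mu>_def[symmetric])
    moreover have "(LINT \<omega>|M. block_dist d p (X' \<omega>) (Xt \<omega>)) = enn2real (mean_dist d p \<mu> \<nu>)"
      using integral_block_dist_indep[OF pair[of 1 2]] by (simp add: X' \<nu> \<mu>_def[symmetric])
    moreover have "(LINT \<omega>|M. block_dist d p (X \<omega>) (X' \<omega>)) = enn2real (mean_dist d p \<mu> \<mu>)"
      using integral_block_dist_indep[OF pair[of 0 1]] by (simp add: X' \<mu>_def[symmetric])
    moreover have "(LINT \<omega>|M. block_dist d p (Xt \<omega>) (Xt' \<omega>)) = enn2real (mean_dist d p \<nu> \<nu>)"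
      using integral_block_dist_indep[OF pair[of 2 3]] by (simp add: Xt' \<nu>)
    ultimately show ?thesis
      unfolding real by simp
  qed
  show ?thesis
    using Q_fin zero_iff repr by blast
qed

end
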